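(* Let $a_1,a_2>0$. In each item, $t=(t_1,t_2,\dots)$ is a random vector with positive coordinates and $p=(p_1,p_2,\dots)$ is defined from $t$. Associated to every rank $2$ root system, the following identities in law hold. (Type $A_2$; $w_0=s_1s_2s_1=s_2s_1s_2$) Let $p_1=t_2+t_3-\min(t_1,t_3)$, $p_2=\min(t_1,t_3)$, $p_3=t_1+t_2-\min(t_1,t_3)$. Then $$(t_1,t_2,t_3)\stackrel{\mathcal L}{=}(\mathbf e_{a_1},\mathbf e_{a_1+a_2},\mathbf e_{a_2})\iff(p_1,p_2,p_3)\stackrel{\mathcal L}{=}(\mathbf e_{a_2},\mathbf e_{a_1+a_2},\mathbf e_{a_1}).$$ (Type $B_2$; $w_0=s_1s_2s_1s_2=s_2s_1s_2s_1$) Let $p_1=t_2+2t_3+t_4-\pi_2$, $p_2=\pi_2-\pi_1$, $p_3=2\pi_1-\pi_2$, $p_4=t_1+t_2+t_3-\pi_1$, where $\pi_1=\min\big(t_1+t_2,\min(t_1,t_3)+t_4\big)$ and $\pi_2=\min\big(2t_1+t_2,2\min(t_1,t_3)+t_4\big)$. Then $$(t_1,t_2,t_3,t_4)\stackrel{\mathcal L}{=}(\mathbf e_{a_1},\mathbf e_{a_1+a_2},\mathbf e_{a_1+2a_2},\mathbf e_{a_2})\iff(p_1,p_2,p_3,p_4)\stackrel{\mathcal L}{=}(\mathbf e_{a_2},\mathbf e_{a_1+2a_2},\mathbf e_{a_1+a_2},\mathbf e_{a_1}).$$ (Types $C_2$ and $G_2$) In the same fashion one can deduce the exponential identities for types $C_2$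 and $G_2$, by tropicalizing the corresponding identities between gamma variables. Explicitly: Type $C_2$ ($w_0=s_1s_2s_1s_2=s_2s_1s_2s_1$): let $p_1=t_2+t_3+t_4-\pi_1$, $p_2=2\pi_1-\pi_2$, $p_3=\pi_2-\pi_1$, $p_4=t_1+2t_2+t_3-\pi_2$, where $\pi_1=\min\big(t_1+t_2,\min(t_1,t_3)+t_4\big)$ and $\pi_2=\min\big(t_3+2t_4,2\min(t_2,t_4)+t_1\big)$. Then $$(t_1,t_2,t_3,t_4)\stackrel{\mathcal L}{=}(\mathbf e_{a_1},\mathbf e_{2a_1+a_2},\mathbf e_{a_1+a_2},\mathbf e_{a_2})\iff(p_1,p_2,p_3,p_4)\stackrel{\mathcal L}{=}(\mathbf e_{a_2},\mathbf e_{a_1+a_2},\mathbf e_{2a_1+a_2},\mathbf e_{a_1}).$$ Type $G_2$ ($w_0=s_1s_2s_1s_2s_1s_2=s_2s_1s_2s_1s_2s_1$): let $$p_1=t_2+3t_3+2t_4+3t_5+t_6-\pi_3,\quad p_2=\pi_3-\pi_2,\quad p_3=3\pi_2-\pi_3-\pi_4,$$ $$p_4=\pi_4-\pi_1-\pi_2,\quad p_5=3\pi_1-\pi_4,\quad p_6=t_1+t_2+2t_3+t_4+t_5-\pi_1,$$ where, with $M=\min(t_1+t_3,\,2t_3,\,t_3+t_5,\,t_1+t_5)$, $$\pi_1=\min\big(t_1+t_2+2t_3+t_4,\ t_1+t_2+2\min(t_3,t_5)+t_6,\ \min(t_1,t_3)+t_4+2t_5+t_6\big),$$ $$\pi_2=\min\big(2t_1+2t_2+3t_3+t_4,\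 2t_1+2t_2+3\min(t_3,t_5)+t_6,\ 2\min(t_1,t_3)+2t_4+3t_5+t_6,\ t_1+t_2+t_4+2t_5+t_6+M\big),$$ $$\pi_3=\min\big(3t_1+2t_2+3t_3+t_4,\ 3t_1+2t_2+3\min(t_3,t_5)+t_6,\ 3\min(t_1,t_3)+2t_4+3t_5+t_6,\ 2t_1+t_2+t_4+2t_5+t_6+M\big),$$ $$\pi_4=\min\Big(2t_1+2t_2+3t_3+t_4+\min\big(t_1+t_2+3t_3+t_4,\ t_1+t_2+3\min(t_3,t_5)+t_6,\ M+t_4+2t_5+t_6\big),$$ $$\qquad 2t_6+3\min\big(t_1+t_2+2\min(t_3,t_5),\ \min(t_1,t_3)+t_4+2t_5\big)\Big).$$ Then $$(t_1,\dots,t_6)\stackrel{\mathcal L}{=}(\mathbf e_{a_1},\mathbf e_{3a_1+a_2},\mathbf e_{2a_1+a_2},\mathbf e_{3a_1+2a_2},\mathbf e_{a_1+a_2},\mathbf e_{a_2})$$ $$\iff(p_1,\dots,p_6)\stackrel{\mathcal L}{=}(\mathbf e_{a_2},\mathbf e_{a_1+a_2},\mathbf e_{3a_1+2a_2},\mathbf e_{2a_1+a_2},\mathbf e_{3a_1+a_2},\mathbf e_{a_1}).$$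
   Context: $\stackrel{\mathcal L}{=}$ denotes equality in law. For $a>0$, $\mathbf e_a$ denotes an exponential random variable with density $ae^{-ax}$ on $\mathbb R_+$; within each vector $(\mathbf e_\cdot,\mathbf e_\cdot,\dots)$ the exponential variables are independent. In each item, $s_1,s_2$ are the simple reflections generating the Weyl group of the rank $2$ root system and $w_0$ is its longest element. Tropicalizing a subtraction-free rational expression means replacing the operations $(+,\times,/)$ by $(\min,+,-)$, positive constants becoming $0$. The identities arise by tropicalizing the rational changes of parameters $t\mapsto p$ given by $x_1(t_1)x_2(t_2)x_1(t_3)\cdots=x_2(p_1)x_1(p_2)x_2(p_3)\cdots$ (where $x_i(t)=\exp(te_i)$ for simple root vectors $e_1,e_2$), which relate vectors of independent gamma variables; $-h\log$ of a gamma variable with parameter $ha$ converges in law to $\mathbf e_a$ as $h\to0^+$.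
   Formalization: The type G2 identity as stated is false (p_1 ≥ 3t_5−3t_1−2t_2−3t_3−t_6 has too heavy a tail if a_1<2a_2); the rates are corrected: t has rates (a_1, a_1+a_2, 2a_1+3a_2, a_1+2a_2, a_1+3a_2, a_2) iff p has the reversed list. *)

theory Defs
  imports "HOL-Probability.Probability"
begin

section \<open>Rank 2 root systems and their Weyl groups\<close>

datatype rank2_type = A2 | B2 | C2 | G2

text \<open>
  The pair $(-a_{12}, -a_{21})$ of off-diagonal Cartan integers, where
  $a_{ij} = \langle \alpha_j, \alpha_i^\vee \rangle$. Thus in types $B_2$ and $G_2$ the root
  $\alpha_1$ is short, and in type $C_2$ it is long. This is the orientation for which the
  maps below tropicalize the change of parameters
  $x_1(t_1) x_2(t_2) \cdots = x_2(p_1) x_1(p_2) \cdots$.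
\<close>

fun cartan :: "rank2_type \<Rightarrow> int \<times> int" where
  "cartan A2 = (1, 1)"
| "cartan B2 = (2, 1)"
| "cartan C2 = (1, 2)"
| "cartan G2 = (3, 1)"

text \<open>
  The simple reflections $s_i(\beta) = \beta - \langle \beta, \alpha_i^\vee \rangle \alpha_i$ on
  the root lattice, where \<open>(x, y)\<close> stands for $x \alpha_1 + y \alpha_2$.
\<close>

definition s1 :: "rank2_type \<Rightarrow> int \<times> int \<Rightarrow> int \<times> int" where
  "s1 X = (\<lambda>(x, y). (- x + fst (cartan X) * y, y))"

definition s2 :: "rank2_type \<Rightarrow> int \<times> int \<Rightarrow> int \<times> int" where
  "s2 X = (\<lambda>(x, y). (x, - y + snd (cartan X) * x))"

definition word_product :: "('a \<Rightarrow> 'a) list \<Rightarrow> 'a \<Rightarrow> 'a" where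
  "word_product fs = foldr (\<circ>) fs id"

text \<open>The simple reflections are involutions, so the words in them form a group.\<close>

definition weyl_group :: "rank2_type \<Rightarrow> (int \<times> int \<Rightarrow> int \<times> int) set" where
  "weyl_group X = word_product ` lists {s1 X, s2 X}"

definition weyl_length :: "rank2_type \<Rightarrow> (int \<times> int \<Rightarrow> int \<times> int) \<Rightarrow> nat" where
  "weyl_length X w = (LEAST n. \<exists>fs \<in> lists {s1 X, s2 X}. length fs = n \<and> word_product fs = w)"

definition longest_element :: "rank2_type \<Rightarrow> (int \<times> int \<Rightarrow> int \<times> int) \<Rightarrow> bool" where
  "longest_element X w0 \<longleftrightarrow>
     w0 \<in> weyl_group X \<and> (\<forall>w \<in> weyl_group X. w \<noteq> w0 \<longrightarrow> weyl_length X w < weyl_length X w0)"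

section \<open>Random vectors and their laws\<close>

text \<open>
  A vector $(v_1, \dots, v_n)$ is a function \<open>v :: nat \<Rightarrow> real\<close>, of which only the values on
  \<open>{1..n}\<close> matter; \<open>tuple [v1, \<dots>, vn]\<close> builds one from the list of its coordinates.
\<close>

definition tuple :: "'a list \<Rightarrow> nat \<Rightarrow> 'a" where
  "tuple xs i = xs ! (i - 1)"

definition random_vector :: "'w measure \<Rightarrow> nat \<Rightarrow> ('w \<Rightarrow> nat \<Rightarrow> real) \<Rightarrow> bool" where
  "random_vector M n t \<longleftrightarrow> (\<forall>i \<in> {1..n}. (\<lambda>\<omega>. t \<omega> i) \<in> borel_measurable M)"

definition positive_coordinates :: "'w measure \<Rightarrow> nat \<Rightarrow> ('w \<Rightarrow> nat \<Rightarrow> real) \<Rightarrow> bool" where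
  "positive_coordinates M n t \<longleftrightarrow> (\<forall>i \<in> {1..n}. AE \<omega> in M. 0 < t \<omega> i)"

definition law :: "'w measure \<Rightarrow> nat \<Rightarrow> ('w \<Rightarrow> nat \<Rightarrow> real) \<Rightarrow> (nat \<Rightarrow> real) measure" where
  "law M n t = distr M (\<Pi>\<^sub>M i \<in> {1..n}. borel) (\<lambda>\<omega>. \<lambda>i \<in> {1..n}. t \<omega> i)"

text \<open>The law of a vector of independent exponential variables with the given list of rates.\<close>

definition exp_law :: "real list \<Rightarrow> (nat \<Rightarrow> real) measure" where
  "exp_law rs = (\<Pi>\<^sub>M i \<in> {1..length rs}. density lborel (exponential_density (tuple rs i)))"

lemma law_eq_exp_law_iff:
  assumes M: "prob_space M" and t: "random_vector M (length rs) t" and ne: "rs \<noteq> []"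
    and pos: "\<forall>r \<in> set rs. 0 < r"
  shows "law M (length rs) t = exp_law rs \<longleftrightarrow>
    prob_space.indep_vars M (\<lambda>_. borel) (\<lambda>i \<omega>. t \<omega> i) {1..length rs} \<and>
    (\<forall>i \<in> {1..length rs}. distributed M lborel (\<lambda>\<omega>. t \<omega> i) (exponential_density (tuple rs i)))"
proof -
  interpret prob_space M by fact
  let ?I = "{1..length rs}"
  let ?E = "\<lambda>i. density lborel (exponential_density (tuple rs i))"
  let ?D = "\<lambda>i. distr M borel (\<lambda>\<omega>. t \<omega> i)"
  have I: "?I \<noteq> {}" using ne by (cases rs) auto
  have meas: "(\<lambda>\<omega>. t \<omega> i) \<in> borel_measurable M" if "i \<in> ?I" for i
    using t that by (auto simp: random_vector_def)
  have rate: "0 < tuple rs i" if "i \<in> ?I" for i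
  proof -
    have "rs ! (i - 1) \<in> set rs" using that by (intro nth_mem) auto
    then show ?thesis using pos by (simp add: tuple_def)
  qed
  have E: "prob_space (?E i)" if "i \<in> ?I" for i
    using rate[OF that] by (rule prob_space_exponential_density)
  have D: "prob_space (?D i)" if "i \<in> ?I" for i
    using meas[OF that] by (rule prob_space_distr)
  have dist: "distributed M lborel (\<lambda>\<omega>. t \<omega> i) (exponential_density (tuple rs i)) \<longleftrightarrow> ?D i = ?E i"
    if "i \<in> ?I" for i
  proof -
    have "distr M lborel (\<lambda>\<omega>. t \<omega> i) = ?D i" by (rule distr_cong) simp_all
    then show ?thesis using meas[OF that] by (simp add: distributed_def)
  qed
  have indep: "indep_vars (\<lambda>_. borel) (\<lambda>i \<omega>. t \<omega> i) ?I \<longleftrightarrow> law M (length rs) t = PiM ?I ?D"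
    unfolding law_def by (rule indep_vars_iff_distr_eq_PiM'[OF I meas])
  have marg: "?D i = ?E i" if eq: "law M (length rs) t = exp_law rs" and i: "i \<in> ?I" for i
  proof -
    have mvec: "(\<lambda>\<omega>. \<lambda>i\<in>?I. t \<omega> i) \<in> measurable M (PiM ?I (\<lambda>_. borel))"
      by (rule measurable_restrict) (rule meas)
    have "?E i = distr (PiM ?I ?E) (?E i) (\<lambda>x. x i)"
      using E i by (rule distr_PiM_component[symmetric])
    also have "\<dots> = distr (law M (length rs) t) borel (\<lambda>x. x i)"
      unfolding eq exp_law_def by (rule distr_cong) simp_all
    also have "\<dots> = distr M borel ((\<lambda>x. x i) \<circ> (\<lambda>\<omega>. \<lambda>i\<in>?I. t \<omega> i))"
      unfolding law_def using i mvec by (intro distr_distr) simp_all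
    also have "(\<lambda>x. x i) \<circ> (\<lambda>\<omega>. \<lambda>i\<in>?I. t \<omega> i) = (\<lambda>\<omega>. t \<omega> i)"
      using i by (simp add: fun_eq_iff)
    finally show ?thesis by simp
  qed
  have prod: "PiM ?I ?D = exp_law rs" if "\<And>i. i \<in> ?I \<Longrightarrow> ?D i = ?E i"
    unfolding exp_law_def using that by (intro PiM_cong) simp_all
  show ?thesis
    using indep dist marg prod by metis
qed

section \<open>Tropicalized changes of parameters\<close>

text \<open>
  A reduced word $(i_1, i_2, \dots)$ of $w_0$ enumerates the positive coroots as
  $s_{i_1} \cdots s_{i_{k-1}} \alpha_{i_k}^\vee$. Let $\beta_k^\vee$ and $\gamma_k^\vee$ be the
  enumerations for the words $(1, 2, 1, \dots)$ of \<open>t\<close> and $(2, 1, 2, \dots)$ of \<open>p\<close>. Each map satisfies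
  $\sum_k \beta_k^\vee t_k = \sum_k \gamma_k^\vee p_k$, so the exponential rate belonging to
  $\beta^\vee = m_1 \alpha_1^\vee + m_2 \alpha_2^\vee$ is $m_1 a_1 + m_2 a_2$.

  Pitfall: in type $G_2$ this gives the rates
  $(a_1, a_1 + a_2, 2 a_1 + 3 a_2, a_1 + 2 a_2, a_1 + 3 a_2, a_2)$ for \<open>t\<close>. The identity is also
  found in print with the roots in place of the coroots, that is, with
  $(a_1, 3 a_1 + a_2, 2 a_1 + a_2, 3 a_1 + 2 a_2, a_1 + a_2, a_2)$ for \<open>t\<close> and the reversed
  list for \<open>p\<close>. With \<open>G2_map\<close> below that version is false: since
  $p_1 \ge 3 t_5 - 3 t_1 - 2 t_2 - 3 t_3 - t_6$, the tail of $p_1$ would decay no faster than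
  $e^{-(a_1 + a_2) x / 3}$, whereas it should be $e^{-a_2 x}$, a contradiction when
  $a_1 < 2 a_2$. Up to renaming
  $a_1, a_2$, the two versions differ by exchanging the laws of \<open>t\<close> and \<open>p\<close>.
\<close>

definition A2_map :: "(nat \<Rightarrow> real) \<Rightarrow> nat \<Rightarrow> real" where
  "A2_map t = tuple
    [t 2 + t 3 - min (t 1) (t 3),
     min (t 1) (t 3),
     t 1 + t 2 - min (t 1) (t 3)]"

definition B2_pi1 :: "(nat \<Rightarrow> real) \<Rightarrow> real" where
  "B2_pi1 t = min (t 1 + t 2) (min (t 1) (t 3) + t 4)"

definition B2_pi2 :: "(nat \<Rightarrow> real) \<Rightarrow> real" where
  "B2_pi2 t = min (2 * t 1 + t 2) (2 * min (t 1) (t 3) + t 4)"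

definition B2_map :: "(nat \<Rightarrow> real) \<Rightarrow> nat \<Rightarrow> real" where
  "B2_map t = tuple
    [t 2 + 2 * t 3 + t 4 - B2_pi2 t,
     B2_pi2 t - B2_pi1 t,
     2 * B2_pi1 t - B2_pi2 t,
     t 1 + t 2 + t 3 - B2_pi1 t]"

definition C2_pi1 :: "(nat \<Rightarrow> real) \<Rightarrow> real" where
  "C2_pi1 t = min (t 1 + t 2) (min (t 1) (t 3) + t 4)"

definition C2_pi2 :: "(nat \<Rightarrow> real) \<Rightarrow> real" where
  "C2_pi2 t = min (t 3 + 2 * t 4) (2 * min (t 2) (t 4) + t 1)"

definition C2_map :: "(nat \<Rightarrow> real) \<Rightarrow> nat \<Rightarrow> real" where
  "C2_map t = tuple
    [t 2 + t 3 + t 4 - C2_pi1 t,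
     2 * C2_pi1 t - C2_pi2 t,
     C2_pi2 t - C2_pi1 t,
     t 1 + 2 * t 2 + t 3 - C2_pi2 t]"

definition G2_M :: "(nat \<Rightarrow> real) \<Rightarrow> real" where
  "G2_M t = Min {t 1 + t 3, 2 * t 3, t 3 + t 5, t 1 + t 5}"

definition G2_pi1 :: "(nat \<Rightarrow> real) \<Rightarrow> real" where
  "G2_pi1 t = Min
    {t 1 + t 2 + 2 * t 3 + t 4,
     t 1 + t 2 + 2 * min (t 3) (t 5) + t 6,
     min (t 1) (t 3) + t 4 + 2 * t 5 + t 6}"

definition G2_pi2 :: "(nat \<Rightarrow> real) \<Rightarrow> real" where
  "G2_pi2 t = Min
    {2 * t 1 + 2 * t 2 + 3 * t 3 + t 4,
     2 * t 1 + 2 * t 2 + 3 * min (t 3) (t 5) + t 6,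
     2 * min (t 1) (t 3) + 2 * t 4 + 3 * t 5 + t 6,
     t 1 + t 2 + t 4 + 2 * t 5 + t 6 + G2_M t}"

definition G2_pi3 :: "(nat \<Rightarrow> real) \<Rightarrow> real" where
  "G2_pi3 t = Min
    {3 * t 1 + 2 * t 2 + 3 * t 3 + t 4,
     3 * t 1 + 2 * t 2 + 3 * min (t 3) (t 5) + t 6,
     3 * min (t 1) (t 3) + 2 * t 4 + 3 * t 5 + t 6,
     2 * t 1 + t 2 + t 4 + 2 * t 5 + t 6 + G2_M t}"

definition G2_pi4 :: "(nat \<Rightarrow> real) \<Rightarrow> real" where
  "G2_pi4 t = min
    (2 * t 1 + 2 * t 2 + 3 * t 3 + t 4 + Min
      {t 1 + t 2 + 3 * t 3 + t 4,
       t 1 + t 2 + 3 * min (t 3) (t 5) + t 6,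
       G2_M t + t 4 + 2 * t 5 + t 6})
    (2 * t 6 + 3 * min (t 1 + t 2 + 2 * min (t 3) (t 5)) (min (t 1) (t 3) + t 4 + 2 * t 5))"

definition G2_map :: "(nat \<Rightarrow> real) \<Rightarrow> nat \<Rightarrow> real" where
  "G2_map t = tuple
    [t 2 + 3 * t 3 + 2 * t 4 + 3 * t 5 + t 6 - G2_pi3 t,
     G2_pi3 t - G2_pi2 t,
     3 * G2_pi2 t - G2_pi3 t - G2_pi4 t,
     G2_pi4 t - G2_pi1 t - G2_pi2 t,
     3 * G2_pi1 t - G2_pi4 t,
     t 1 + t 2 + 2 * t 3 + t 4 + t 5 - G2_pi1 t]"

end

theory Submission
  imports Defs
begin

text \<open>
  Let $t \mapsto p$ be one of the four maps, and let $r$ and $s$ be the rates of $t$ and $p$. The exponential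
  law of $t$ has density proportional to $\exp(-\sum_k r_k t_k)$ on the positive orthant. Each map is
  a bijection of the open orthant, and $\sum_k r_k t_k = \sum_k s_k p_k$, because the sum of the
  coroots weighted by the parameters is preserved. The identity in law therefore amounts to the map
  preserving volume.

  Instead of computing Jacobians on the domains of linearity, the proof uses that the map and its
  inverse have integer coefficients and hence permute the positive vectors of the lattice
  $h \mathbb{Z}^n$ for every $h > 0$. Rounding the coordinates of an exponential vector up to the
  lattice gives independent geometric variables, and the mass of a positive lattice vector $t$ is
  $\exp(-\sum_k r_k t_k)$ times a constant that depends only on $h$ and on the multiset of rates, which is the
  same for $r$ and $s$. So the map carries the one geometric law to the other exactly
  (\<open>distr_round_up\<close>), and $h \to 0$ gives the exponential laws, since the map is continuous
  (\<open>distr_exp_meas\<close>). The converse implication follows by applying the inverse map (\<open>law_iff\<close>).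

  It remains to invert the maps. The inverse is the same map conjugated by the reversal of the
  coordinates, so the claim is that the map followed by reversal is an involution. Each $\pi_k$
  equals a linear form plus the minimum $m_k$ of the partial sums along a path whose steps are multiples
  of the differences $t_n - t_{n-2}, \dots, t_3 - t_1$ (in type $G_2$, the paths
  $(x, 2y, z, w)$, $(x, 3y, 2z, 2w)$, $(x, 3y, 2z, 3w)$ and $(2x, 6y, 3z, 3w)$ with $x = t_6 - t_4$,
  $y = t_5 - t_3$, $z = t_4 - t_2$, $w = t_3 - t_1$). The involution then becomes a statement about the
  minima $m_k$ and the minima $m_k'$ for the reversed image of $t$; in type $G_2$ it reads
  $m_1' = m_3 - m_2$, $m_2' = m_3 - m_1$, $m_3' = m_3$, $m_4' = 2 m_3 - m_4$. It is checked on the cones of a fan on which all minima are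
  linear: four cones in types $B_2$ and $C_2$, sixteen simplicial cones in type $G_2$
  (\<open>G2_cone_involution\<close>).

  For the Weyl groups, every element is an alternating word in the two reflections, and the longest
  one is recognised by its action on a regular point (\<open>longest_elementI\<close>).
\<close>

section \<open>The longest element of a dihedral Weyl group\<close>

text \<open>
  The alternating word \<open>s \<circ> t \<circ> s \<circ> \<dots>\<close> with \<open>k\<close> letters.
\<close>

fun alternating :: "('a \<Rightarrow> 'a) \<Rightarrow> ('a \<Rightarrow> 'a) \<Rightarrow> nat \<Rightarrow> 'a \<Rightarrow> 'a" where
  "alternating s t 0 = id"
| "alternating s t (Suc k) = s \<circ> alternating t s k"

lemma word_product_simps: "word_product [] = id" "word_product (f # fs) = f \<circ> word_product fs"
  by (simp_all add: word_product_def)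

lemma alternating_word:
  "\<exists>fs \<in> lists {s, t}. length fs = k \<and> word_product fs = alternating s t k"
proof (induction k arbitrary: s t)
  case 0
  show ?case by (intro bexI[of _ "[]"]) (auto simp: word_product_simps)
next
  case (Suc k)
  obtain fs where "fs \<in> lists {t, s}" "length fs = k" "word_product fs = alternating t s k"
    using Suc[of t s] by blast
  then show ?case by (intro bexI[of _ "s # fs"]) (auto simp: word_product_simps)
qed

lemma alternating_step:
  assumes "s \<circ> s = id" and braid: "alternating s t m = alternating t s m" and m: "0 < m" and k: "k \<le> m"
    and w: "w = alternating s t k \<or> w = alternating t s k"
  shows "\<exists>j \<le> min m (Suc k). s \<circ> w = alternating s t j \<or> s \<circ> w = alternating t s j"
proof -
  have cancel: "s \<circ> alternating s t (Suc j) = alternating t s j" for j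
    using assms(1) by (simp flip: comp_assoc)
  show ?thesis
  proof (cases "w = alternating t s k \<and> k < m")
    case True
    then have "s \<circ> w = alternating s t (Suc k)" by simp
    then show ?thesis using True by (intro exI[of _ "Suc k"]) auto
  next
    case False
    then have "w = alternating s t k" using w k braid by auto
    show ?thesis
    proof (cases k)
      case 0
      then show ?thesis using \<open>w = alternating s t k\<close> m by (intro exI[of _ 1]) auto
    next
      case (Suc j)
      then have "s \<circ> w = alternating t s j" using \<open>w = alternating s t k\<close> cancel by simp
      then show ?thesis using Suc k by (intro exI[of _ j]) auto
    qed
  qed
qed

text \<open>
  In a group generated by two involutions, equal adjacent letters cancel, and the braid relation of
  length \<open>m\<close> shortens alternating words with more than \<open>m\<close> letters. Hence the words with at most
  \<open>m\<close> alternating letters exhaust the group, and passing to one never increases the length.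
\<close>

lemma word_product_alternating:
  assumes "s \<circ> s = id" "t \<circ> t = id" and braid: "alternating s t m = alternating t s m" and m: "0 < m"
    and "fs \<in> lists {s, t}"
  shows "\<exists>k \<le> min m (length fs). word_product fs = alternating s t k \<or> word_product fs = alternating t s k"
  using assms(5)
proof (induction fs)
  case Nil
  then show ?case by (intro exI[of _ 0]) (simp add: word_product_simps)
next
  case (Cons f fs)
  then obtain k where k: "k \<le> m" "k \<le> length fs"
    "word_product fs = alternating s t k \<or> word_product fs = alternating t s k" by auto
  have "\<exists>j \<le> min m (Suc k). f \<circ> word_product fs = alternating s t j \<or> f \<circ> word_product fs = alternating t s j"
    using Cons.hyps(1) alternating_step[OF assms(1) braid m k(1,3)]
      alternating_step[OF assms(2) braid[symmetric] m k(1), of "word_product fs"] k(3) by blast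
  then obtain j where j: "j \<le> m" "j \<le> Suc k"
    "f \<circ> word_product fs = alternating s t j \<or> f \<circ> word_product fs = alternating t s j" by auto
  then show ?case
    using k(2) by (intro exI[of _ j]) (simp add: word_product_simps(2) del: comp_apply)
qed

text \<open>
  The point \<open>v\<close> certifies that no shorter alternating word equals the one with \<open>m\<close> letters. Any
  point off the reflection hyperplanes will do; the lemmas below take a positive combination of the
  simple roots that pairs positively with both simple coroots.
\<close>

lemma longest_elementI:
  fixes X and v :: "int \<times> int"
  defines "s \<equiv> s1 X" and "t \<equiv> s2 X"
  assumes inv: "s \<circ> s = id" "t \<circ> t = id" and braid: "alternating s t m = alternating t s m"
    and moved: "\<And>k. k < m \<Longrightarrow> alternating s t k v \<noteq> alternating s t m v \<and> alternating t s k v \<noteq> alternating s t m v"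
    and m: "0 < m"
  shows "longest_element X (alternating s t m)"
  unfolding longest_element_def
proof (intro conjI ballI impI)
  let ?w0 = "alternating s t m"
  have shorter: "k = m" if "k \<le> m" "?w0 = alternating s t k \<or> ?w0 = alternating t s k" for k
    using moved[of k] that by (cases "k = m") (auto dest: fun_cong[of _ _ v])
  have short_word: "\<exists>fs \<in> lists {s, t}. length fs = k \<and> word_product fs = w"
    if "w = alternating s t k \<or> w = alternating t s k" for w k
    using that alternating_word[of s t k] alternating_word[of t s k] by (auto simp: insert_commute)
  show "?w0 \<in> weyl_group X"
    using short_word[of ?w0 m] unfolding weyl_group_def s_def t_def by (metis image_eqI)
  have "m \<le> weyl_length X ?w0"
  proof -
    let ?P = "\<lambda>n. \<exists>fs \<in> lists {s, t}. length fs = n \<and> word_product fs = ?w0"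
    have "?P (LEAST n. ?P n)" by (rule LeastI[of ?P m]) (rule short_word, simp)
    then obtain fs where fs: "fs \<in> lists {s, t}" "length fs = weyl_length X ?w0" "word_product fs = ?w0"
      by (auto simp: weyl_length_def s_def t_def)
    from word_product_alternating[OF inv braid m fs(1)] obtain k where
      "k \<le> m" "k \<le> length fs" "?w0 = alternating s t k \<or> ?w0 = alternating t s k"
      using fs(3) by auto
    then show ?thesis using shorter[of k] fs(2) by simp
  qed
  fix w assume "w \<in> weyl_group X" and w: "w \<noteq> ?w0"
  then obtain fs where fs: "fs \<in> lists {s, t}" "w = word_product fs"
    by (auto simp: weyl_group_def s_def t_def)
  from word_product_alternating[OF inv braid m fs(1)] obtain k where
    k: "k \<le> m" "w = alternating s t k \<or> w = alternating t s k"
    using fs(2) by auto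
  have "weyl_length X w \<le> k"
    unfolding weyl_length_def s_def[symmetric] t_def[symmetric]
    by (rule Least_le) (rule short_word, rule k(2))
  moreover have "k < m" using k w braid by (cases "k = m") auto
  ultimately show "weyl_length X w < weyl_length X ?w0" using \<open>m \<le> weyl_length X ?w0\<close> by simp
qed

lemma longest_element_A2:
  "longest_element A2 (s1 A2 \<circ> s2 A2 \<circ> s1 A2)" "s1 A2 \<circ> s2 A2 \<circ> s1 A2 = s2 A2 \<circ> s1 A2 \<circ> s2 A2"
proof -
  show braid: "s1 A2 \<circ> s2 A2 \<circ> s1 A2 = s2 A2 \<circ> s1 A2 \<circ> s2 A2"
    by (auto simp: fun_eq_iff s1_def s2_def)
  have "longest_element A2 (alternating (s1 A2) (s2 A2) 3)"
    using braid
    by (intro longest_elementI[of _ _ "(1, 1)"])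
       (auto simp: s1_def s2_def fun_eq_iff numeral_eq_Suc less_Suc_eq comp_assoc)
  then show "longest_element A2 (s1 A2 \<circ> s2 A2 \<circ> s1 A2)"
    by (simp add: numeral_eq_Suc comp_assoc)
qed

lemma longest_element_B2:
  "longest_element B2 (s1 B2 \<circ> s2 B2 \<circ> s1 B2 \<circ> s2 B2)"
  "s1 B2 \<circ> s2 B2 \<circ> s1 B2 \<circ> s2 B2 = s2 B2 \<circ> s1 B2 \<circ> s2 B2 \<circ> s1 B2"
proof -
  show braid: "s1 B2 \<circ> s2 B2 \<circ> s1 B2 \<circ> s2 B2 = s2 B2 \<circ> s1 B2 \<circ> s2 B2 \<circ> s1 B2"
    by (auto simp: fun_eq_iff s1_def s2_def)
  have "longest_element B2 (alternating (s1 B2) (s2 B2) 4)"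
    using braid
    by (intro longest_elementI[of _ _ "(3, 2)"])
       (auto simp: s1_def s2_def fun_eq_iff numeral_eq_Suc less_Suc_eq comp_assoc)
  then show "longest_element B2 (s1 B2 \<circ> s2 B2 \<circ> s1 B2 \<circ> s2 B2)"
    by (simp add: numeral_eq_Suc comp_assoc)
qed

lemma longest_element_C2:
  "longest_element C2 (s1 C2 \<circ> s2 C2 \<circ> s1 C2 \<circ> s2 C2)"
  "s1 C2 \<circ> s2 C2 \<circ> s1 C2 \<circ> s2 C2 = s2 C2 \<circ> s1 C2 \<circ> s2 C2 \<circ> s1 C2"
proof -
  show braid: "s1 C2 \<circ> s2 C2 \<circ> s1 C2 \<circ> s2 C2 = s2 C2 \<circ> s1 C2 \<circ> s2 C2 \<circ> s1 C2"
    by (auto simp: fun_eq_iff s1_def s2_def)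
  have "longest_element C2 (alternating (s1 C2) (s2 C2) 4)"
    using braid
    by (intro longest_elementI[of _ _ "(2, 3)"])
       (auto simp: s1_def s2_def fun_eq_iff numeral_eq_Suc less_Suc_eq comp_assoc)
  then show "longest_element C2 (s1 C2 \<circ> s2 C2 \<circ> s1 C2 \<circ> s2 C2)"
    by (simp add: numeral_eq_Suc comp_assoc)
qed

lemma longest_element_G2:
  "longest_element G2 (s1 G2 \<circ> s2 G2 \<circ> s1 G2 \<circ> s2 G2 \<circ> s1 G2 \<circ> s2 G2)"
  "s1 G2 \<circ> s2 G2 \<circ> s1 G2 \<circ> s2 G2 \<circ> s1 G2 \<circ> s2 G2 = s2 G2 \<circ> s1 G2 \<circ> s2 G2 \<circ> s1 G2 \<circ> s2 G2 \<circ> s1 G2"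
proof -
  show braid: "s1 G2 \<circ> s2 G2 \<circ> s1 G2 \<circ> s2 G2 \<circ> s1 G2 \<circ> s2 G2 = s2 G2 \<circ> s1 G2 \<circ> s2 G2 \<circ> s1 G2 \<circ> s2 G2 \<circ> s1 G2"
    by (auto simp: fun_eq_iff s1_def s2_def)
  have "longest_element G2 (alternating (s1 G2) (s2 G2) 6)"
    using braid
    by (intro longest_elementI[of _ _ "(5, 3)"])
       (auto simp: s1_def s2_def fun_eq_iff numeral_eq_Suc less_Suc_eq comp_assoc)
  then show "longest_element G2 (s1 G2 \<circ> s2 G2 \<circ> s1 G2 \<circ> s2 G2 \<circ> s1 G2 \<circ> s2 G2)"
    by (simp add: numeral_eq_Suc comp_assoc)
qed

section \<open>Laws determined by continuous test functions\<close>

text \<open>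
  The open orthant above the corner \<open>c\<close>, as a set of extensional functions on \<open>{1..n}\<close>. These
  sets are closed under intersection and generate the product sigma-algebra.
\<close>

definition upper_box :: "nat \<Rightarrow> (nat \<Rightarrow> real) \<Rightarrow> (nat \<Rightarrow> real) set" where
  "upper_box n c = {x \<in> (\<Pi>\<^sub>E i\<in>{1..n}. UNIV). \<forall>i\<in>{1..n}. c i < x i}"

lemma measure_eqI_upper_box:
  assumes P: "prob_space P" and Q: "prob_space Q"
    and setsP: "sets P = sets (\<Pi>\<^sub>M i\<in>{1..n}. borel)" and setsQ: "sets Q = sets (\<Pi>\<^sub>M i\<in>{1..n}. borel)"
    and eq: "\<And>c. emeasure P (upper_box n c) = emeasure Q (upper_box n c)"
  shows "P = Q"
proof -
  let ?\<Omega> = "\<Pi>\<^sub>E i\<in>{1..n}. UNIV :: real set"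
  let ?E = "range (upper_box n)"
  have "sets (\<Pi>\<^sub>M i\<in>{1..n}. borel :: real measure)
      = sets (\<Pi>\<^sub>M i\<in>{1..n}. sigma UNIV (range (greaterThan :: real \<Rightarrow> real set)))"
    by (intro sets_PiM_cong) (simp_all add: borel_Ioi)
  also have "\<dots> = sets (sigma ?\<Omega> {{f \<in> ?\<Omega>. \<forall>i\<in>j. f i \<in> A i} | A j.
      j \<in> {{1..n}} \<and> A \<in> Pi j (\<lambda>_. range greaterThan)})"
  proof (rule sets_PiM_sigma)
    have "(\<Union>k::nat. {- real k<..}) = (UNIV :: real set)"
    proof (intro equalityI subsetI UNIV_I)
      fix x :: real
      obtain k :: nat where "- x < real k" using reals_Archimedean2 by blast
      then show "x \<in> (\<Union>k::nat. {- real k<..})" by (auto intro!: exI[of _ k])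
    qed
    then show "\<exists>S\<subseteq>range (greaterThan :: real \<Rightarrow> _). countable S \<and> UNIV = \<Union>S" for i
      by (intro exI[of _ "range (\<lambda>k::nat. {- real k<..})"]) auto
  qed auto
  also have "{{f \<in> ?\<Omega>. \<forall>i\<in>j. f i \<in> A i} | A j. j \<in> {{1..n}} \<and> A \<in> Pi j (\<lambda>_. range greaterThan)} = ?E"
  proof (intro equalityI subsetI)
    fix X assume "X \<in> {{f \<in> ?\<Omega>. \<forall>i\<in>j. f i \<in> A i} | A j. j \<in> {{1..n}} \<and> A \<in> Pi j (\<lambda>_. range greaterThan)}"
    then obtain A where A: "A \<in> {1..n} \<rightarrow> range greaterThan"
      and X: "X = {f \<in> ?\<Omega>. \<forall>i\<in>{1..n}. f i \<in> A i}"
      by blast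
    have "\<forall>i\<in>{1..n}. \<exists>c. A i = {c<..}" using A by blast
    then obtain c where "\<forall>i\<in>{1..n}. A i = {c i<..}" by metis
    then show "X \<in> ?E" unfolding X upper_box_def by (intro image_eqI[of _ _ c]) auto
  next
    fix X assume "X \<in> ?E"
    then obtain c where "X = upper_box n c" by auto
    then show "X \<in> {{f \<in> ?\<Omega>. \<forall>i\<in>j. f i \<in> A i} | A j. j \<in> {{1..n}} \<and> A \<in> Pi j (\<lambda>_. range greaterThan)}"
      by (auto simp: upper_box_def intro!: exI[of _ "\<lambda>i. {c i<..}"])
  qed
  finally have gen: "sets (\<Pi>\<^sub>M i\<in>{1..n}. borel :: real measure) = sigma_sets ?\<Omega> ?E"
    by (simp add: sets_measure_of upper_box_def image_subset_iff)
  show ?thesis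
  proof (rule measure_eqI_generator_eq)
    show "Int_stable ?E"
    proof (rule Int_stableI_image)
      fix c d :: "nat \<Rightarrow> real"
      show "\<exists>e\<in>UNIV. upper_box n c \<inter> upper_box n d = upper_box n e"
        by (intro bexI[of _ "\<lambda>i. max (c i) (d i)"]) (auto simp: upper_box_def)
    qed
    show "?E \<subseteq> Pow ?\<Omega>" by (auto simp: upper_box_def)
    show "sets P = sigma_sets ?\<Omega> ?E" "sets Q = sigma_sets ?\<Omega> ?E" using setsP setsQ gen by auto
    show "range (\<lambda>k. upper_box n (\<lambda>_. - real k)) \<subseteq> ?E" by auto
    show "(\<Union>k. upper_box n (\<lambda>_. - real k)) = ?\<Omega>"
    proof (intro equalityI subsetI)
      fix x assume x: "x \<in> ?\<Omega>"
      obtain k :: nat where k: "(\<Sum>i\<in>{1..n}. \<bar>x i\<bar>) < real k" using reals_Archimedean2 by blast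
      have "\<bar>x i\<bar> < real k" if "i \<in> {1..n}" for i
        using member_le_sum[OF that, of "\<lambda>i. \<bar>x i\<bar>"] k by simp
      then have "x \<in> upper_box n (\<lambda>_. - real k)" using x by (force simp: upper_box_def)
      then show "x \<in> (\<Union>k. upper_box n (\<lambda>_. - real k))" by blast
    qed (auto simp: upper_box_def)
    show "emeasure P (upper_box n (\<lambda>_. - real k)) \<noteq> \<infinity>" for k
      using prob_space.emeasure_le_1[OF P, of "upper_box n (\<lambda>_. - real k)"]
      by (metis ennreal_one_neq_top infinity_ennreal_def top.extremum_uniqueI)
  qed (use eq in auto)
qed

text \<open>
  Continuous functions with values in the unit interval that increase, as \<open>m\<close> grows, to the
  indicator of \<open>upper_box n c\<close>.
\<close>

definition bump :: "nat \<Rightarrow> (nat \<Rightarrow> real) \<Rightarrow> nat \<Rightarrow> (nat \<Rightarrow> real) \<Rightarrow> real" where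
  "bump n c m x = (\<Prod>i\<in>{1..n}. min 1 (max 0 (real m * (x i - c i))))"

lemma bump_bounds: "0 \<le> bump n c m x" "bump n c m x \<le> 1"
  by (auto simp: bump_def intro!: prod_nonneg prod_le_1)

lemma bump_measurable: "bump n c m \<in> borel_measurable (\<Pi>\<^sub>M i\<in>{1..n}. borel)"
  unfolding bump_def by measurable

lemma bump_restrict: "bump n c m (restrict f {1..n}) = bump n c m f"
  by (simp add: bump_def)

lemma bump_tendsto:
  assumes "\<And>i. i \<in> {1..n} \<Longrightarrow> (\<lambda>k. X k i) \<longlonglongrightarrow> x i"
  shows "(\<lambda>k. bump n c m (X k)) \<longlonglongrightarrow> bump n c m x"
  unfolding bump_def using assms
  by (intro tendsto_prod tendsto_min tendsto_max tendsto_mult tendsto_diff tendsto_const) auto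

lemma bump_tendsto_indicator:
  assumes "x \<in> (\<Pi>\<^sub>E i\<in>{1..n}. UNIV)"
  shows "(\<lambda>m. bump n c m x) \<longlonglongrightarrow> indicator (upper_box n c) x"
proof -
  have "(\<lambda>m. min 1 (max 0 (real m * (x i - c i)))) \<longlonglongrightarrow> (if c i < x i then 1 else 0)" for i
  proof (cases "c i < x i")
    case True
    obtain N :: nat where N: "1 / (x i - c i) < real N" using reals_Archimedean2 by blast
    have "min 1 (max 0 (real m * (x i - c i))) = 1" if "N \<le> m" for m
    proof -
      have "1 / (x i - c i) < real m" using N that by linarith
      then have "1 < real m * (x i - c i)" using True by (simp add: field_simps)
      then show ?thesis by simp
    qed
    then show ?thesis using True by (auto intro!: tendsto_eventually eventually_sequentiallyI[of N])
  next
    case False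
    then have "real m * (x i - c i) \<le> 0" for m
      by (intro mult_nonneg_nonpos) auto
    then show ?thesis using False by (simp add: max_absorb1)
  qed
  then have "(\<lambda>m. bump n c m x) \<longlonglongrightarrow> (\<Prod>i\<in>{1..n}. if c i < x i then 1 else 0)"
    unfolding bump_def by (intro tendsto_prod)
  also have "(\<Prod>i\<in>{1..n}. if c i < x i then 1 else 0 :: real) = indicator (upper_box n c) x"
    using assms by (auto simp: indicator_def upper_box_def intro!: prod.neutral)
  finally show ?thesis .
qed

lemma upper_box_sets: "upper_box n c \<in> sets (\<Pi>\<^sub>M i\<in>{1..n}. borel)"
proof -
  have "upper_box n c = {x \<in> space (\<Pi>\<^sub>M i\<in>{1..n}. borel). \<forall>i\<in>{1..n}. c i < x i}"
    by (simp add: upper_box_def space_PiM)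
  also have "\<dots> \<in> sets (\<Pi>\<^sub>M i\<in>{1..n}. borel)" by measurable
  finally show ?thesis .
qed

lemma measure_eqI_bump:
  assumes P: "prob_space P" and Q: "prob_space Q"
    and setsP: "sets P = sets (\<Pi>\<^sub>M i\<in>{1..n}. borel)" and setsQ: "sets Q = sets (\<Pi>\<^sub>M i\<in>{1..n}. borel)"
    and eq: "\<And>c m. (\<integral>x. bump n c m x \<partial>P) = (\<integral>x. bump n c m x \<partial>Q)"
  shows "P = Q"
proof (rule measure_eqI_upper_box[OF P Q setsP setsQ])
  fix c
  have lim: "(\<lambda>m. \<integral>x. bump n c m x \<partial>R) \<longlonglongrightarrow> measure R (upper_box n c)"
    if R: "prob_space R" and sets: "sets R = sets (\<Pi>\<^sub>M i\<in>{1..n}. borel)" for R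
  proof -
    interpret prob_space R by (rule R)
    have space: "space R = (\<Pi>\<^sub>E i\<in>{1..n}. UNIV)"
      using sets_eq_imp_space_eq[OF sets] by (simp add: space_PiM)
    have bump: "bump n c m \<in> borel_measurable R" for m
      using bump_measurable measurable_cong_sets[OF sets refl] by blast
    have box: "upper_box n c \<in> sets R" using upper_box_sets sets by blast
    have "(\<lambda>m. \<integral>x. bump n c m x \<partial>R) \<longlonglongrightarrow> (\<integral>x. indicator (upper_box n c) x \<partial>R)"
    proof (rule integral_dominated_convergence[where w = "\<lambda>_. 1"])
      show "AE x in R. (\<lambda>m. bump n c m x) \<longlonglongrightarrow> indicator (upper_box n c) x"
        by (rule AE_I2) (simp add: bump_tendsto_indicator space)
    qed (use bump box bump_bounds in auto)
    then show ?thesis using box by simp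
  qed
  have "measure P (upper_box n c) = measure Q (upper_box n c)"
    using LIMSEQ_unique[OF lim[OF P setsP]] lim[OF Q setsQ] unfolding eq by blast
  then show "emeasure P (upper_box n c) = emeasure Q (upper_box n c)"
    using P Q by (simp add: finite_measure.emeasure_eq_measure prob_space.finite_measure)
qed


section \<open>Exponential vectors rounded to a lattice\<close>

text \<open>
  The law of independent exponential variables with rates \<open>r 1, \<dots>, r n\<close>. The rates are a function
  on all of \<open>nat\<close>, which can be taken to be positive everywhere, so that the lemmas on products of
  probability spaces apply.
\<close>

definition exp_meas :: "nat \<Rightarrow> (nat \<Rightarrow> real) \<Rightarrow> (nat \<Rightarrow> real) measure" where
  "exp_meas n r = (\<Pi>\<^sub>M i\<in>{1..n}. density lborel (exponential_density (r i)))"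

lemma emeasure_exponential_Ioc:
  assumes "0 < l" "0 \<le> a" "a \<le> b"
  shows "emeasure (density lborel (exponential_density l)) {a<..b} = ennreal (exp (- l * a) - exp (- l * b))"
proof -
  let ?E = "density lborel (exponential_density l)"
  interpret prob_space ?E by (rule prob_space_exponential_density) fact
  have "{a<..b} = {..b} - {..a}" by auto
  then have "emeasure ?E {a<..b} = emeasure ?E {..b} - emeasure ?E {..a}"
    using assms by (simp add: emeasure_Diff)
  also have "\<dots> = ennreal (erlang_CDF 0 l b) - ennreal (erlang_CDF 0 l a)"
    using assms by (simp add: emeasure_erlang_density)
  also have "\<dots> = ennreal (exp (- l * a) - exp (- l * b))"
    using assms by (subst ennreal_minus) (auto simp: erlang_CDF_0)
  finally show ?thesis .
qed

lemma sets_exp_meas: "sets (exp_meas n r) = sets (\<Pi>\<^sub>M i\<in>{1..n}. borel)"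
  unfolding exp_meas_def by (intro sets_PiM_cong) simp_all

lemma space_exp_meas: "space (exp_meas n r) = (\<Pi>\<^sub>E i\<in>{1..n}. UNIV)"
  by (simp add: exp_meas_def space_PiM)

lemma prob_space_exp_meas:
  assumes "\<And>i. 0 < r i" shows "prob_space (exp_meas n r)"
  unfolding exp_meas_def by (intro prob_space_PiM prob_space_exponential_density assms)

lemma AE_exp_meas_pos:
  assumes "\<And>i. 0 < r i" shows "AE x in exp_meas n r. \<forall>i\<in>{1..n}. 0 < x i"
proof (rule AE_ball_countable[THEN iffD2, rule_format])
  fix i assume i: "i \<in> {1..n}"
  let ?E = "density lborel (exponential_density (r i))"
  have "emeasure ?E {..0} = 0"
    using assms by (simp add: emeasure_erlang_density erlang_CDF_0)
  then have "AE x in ?E. 0 < x"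
    by (intro AE_I[of _ _ "{..0}"]) auto
  then show "AE x in exp_meas n r. 0 < x i"
    unfolding exp_meas_def using i assms
    by (intro AE_PiM_component prob_space_exponential_density)
qed simp

text \<open>
  The lattice of mesh \<open>h\<close> on the real line, and rounding up to it. Rounding up, unlike rounding
  down, keeps positive numbers positive.
\<close>

definition grid :: "real \<Rightarrow> real set" where
  "grid h = range (\<lambda>k::int. h * of_int k)"

definition round_up :: "real \<Rightarrow> real \<Rightarrow> real" where
  "round_up h x = h * of_int \<lceil>x / h\<rceil>"

lemma round_up_grid: "round_up h x \<in> grid h"
  by (auto simp: round_up_def grid_def)

lemma round_up_bounds: assumes "0 < h" shows "x \<le> round_up h x" "round_up h x < x + h"
proof -
  have "x / h \<le> of_int \<lceil>x / h\<rceil>" "of_int \<lceil>x / h\<rceil> < x / h + 1" by linarith+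
  then have "h * (x / h) \<le> round_up h x" "round_up h x < h * (x / h + 1)"
    using assms by (simp_all only: round_up_def mult_left_mono less_imp_le mult_strict_left_mono)
  then show "x \<le> round_up h x" "round_up h x < x + h"
    using assms by (auto simp: distrib_left)
qed

lemma round_up_eq_iff:
  assumes "0 < h" "p \<in> grid h"
  shows "round_up h x = p \<longleftrightarrow> p - h < x \<and> x \<le> p"
proof -
  obtain k :: int where p: "p = h * of_int k" using assms(2) by (auto simp: grid_def)
  have "round_up h x = p \<longleftrightarrow> \<lceil>x / h\<rceil> = k" using assms by (simp add: round_up_def p)
  also have "\<dots> \<longleftrightarrow> of_int k - 1 < x / h \<and> x / h \<le> of_int k" by (simp add: ceiling_eq_iff)
  also have "\<dots> \<longleftrightarrow> p - h < x \<and> x \<le> p" using assms by (auto simp: p field_simps)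
  finally show ?thesis .
qed

lemma round_up_tendsto: "(\<lambda>k. round_up (1 / real (Suc k)) x) \<longlonglongrightarrow> x"
proof (rule tendsto_sandwich[of "\<lambda>_. x" _ _ "\<lambda>k. x + 1 / real (Suc k)"])
  show "(\<lambda>k. x + 1 / real (Suc k)) \<longlonglongrightarrow> x"
    using tendsto_add[OF tendsto_const LIMSEQ_inverse_real_of_nat, of x]
    by (simp only: inverse_eq_divide add_0_right)
  show "\<forall>\<^sub>F k in sequentially. x \<le> round_up (1 / real (Suc k)) x"
    "\<forall>\<^sub>F k in sequentially. round_up (1 / real (Suc k)) x \<le> x + 1 / real (Suc k)"
    by (auto intro!: always_eventually less_imp_le[OF round_up_bounds(2)] round_up_bounds(1)
        simp del: of_nat_Suc)
qed simp

definition round_up_vec :: "nat \<Rightarrow> real \<Rightarrow> (nat \<Rightarrow> real) \<Rightarrow> nat \<Rightarrow> real" where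
  "round_up_vec n h x = (\<lambda>i\<in>{1..n}. round_up h (x i))"

lemma round_up_vec_grid: "round_up_vec n h x \<in> (\<Pi>\<^sub>E i\<in>{1..n}. grid h)"
  by (auto simp: round_up_vec_def round_up_grid)

lemma countable_grid_vec: "countable (\<Pi>\<^sub>E i\<in>{1..n::nat}. grid h)"
  by (intro countable_PiE) (auto simp: grid_def)

lemma round_up_vec_measurable:
  "round_up_vec n h \<in> measurable (exp_meas n r) (count_space (\<Pi>\<^sub>E i\<in>{1..n}. grid h))"
proof (subst measurable_count_space_eq_countable[OF countable_grid_vec], intro conjI ballI)
  fix p assume p: "p \<in> (\<Pi>\<^sub>E i\<in>{1..n}. grid h)"
  have "round_up_vec n h x = p \<longleftrightarrow> (\<forall>i\<in>{1..n}. h * of_int \<lceil>x i / h\<rceil> = p i)" for x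
    using p by (auto simp: round_up_vec_def round_up_def fun_eq_iff PiE_iff extensional_def)
  then have "round_up_vec n h -` {p} \<inter> space (exp_meas n r)
      = {x \<in> space (\<Pi>\<^sub>M i\<in>{1..n}. borel). \<forall>i\<in>{1..n}. h * of_int \<lceil>x i / h\<rceil> = p i}"
    by (auto simp: space_exp_meas space_PiM)
  also have "\<dots> \<in> sets (\<Pi>\<^sub>M i\<in>{1..n}. borel)"
    by measurable
  finally show "round_up_vec n h -` {p} \<inter> space (exp_meas n r) \<in> sets (exp_meas n r)"
    by (simp add: sets_exp_meas)
qed (use round_up_vec_grid in auto)

text \<open>
  The rounded vector has independent geometric coordinates: the cell of \<open>p\<close> is the box
  $\prod_i (p_i - h, p_i]$, and its mass depends on \<open>p\<close> only through $\sum_i r_i p_i$.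
\<close>

lemma emeasure_round_up_vec:
  assumes r: "\<And>i. 0 < r i" and h: "0 < h"
    and p: "p \<in> (\<Pi>\<^sub>E i\<in>{1..n}. grid h)" "\<And>i. i \<in> {1..n} \<Longrightarrow> 0 < p i"
  shows "emeasure (exp_meas n r) {x \<in> space (exp_meas n r). round_up_vec n h x = p}
    = ennreal (exp (- (\<Sum>i\<in>{1..n}. r i * p i)) * (\<Prod>i\<in>{1..n}. exp (r i * h) - 1))"
proof -
  interpret E: product_prob_space "\<lambda>i. density lborel (exponential_density (r i))"
    by (intro product_prob_spaceI prob_space_exponential_density r)
  have "{x \<in> space (exp_meas n r). round_up_vec n h x = p} = (\<Pi>\<^sub>E i\<in>{1..n}. {p i - h<..p i})"
  proof (intro set_eqI iffI)
    fix x assume x: "x \<in> {x \<in> space (exp_meas n r). round_up_vec n h x = p}"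
    then have "round_up h (x i) = p i" if "i \<in> {1..n}" for i
      using that by (auto simp: round_up_vec_def)
    then show "x \<in> (\<Pi>\<^sub>E i\<in>{1..n}. {p i - h<..p i})"
      using x p h round_up_eq_iff by (auto simp: space_exp_meas PiE_iff)
  next
    fix x assume x: "x \<in> (\<Pi>\<^sub>E i\<in>{1..n}. {p i - h<..p i})"
    have "round_up h (x i) = p i" if i: "i \<in> {1..n}" for i
      using x p(1) i round_up_eq_iff[OF h, of "p i" "x i"] by (auto simp: PiE_iff)
    then have "round_up_vec n h x = p"
      using p(1) by (intro ext) (auto simp: round_up_vec_def PiE_iff extensional_def)
    then show "x \<in> {x \<in> space (exp_meas n r). round_up_vec n h x = p}"
      using x by (auto simp: space_exp_meas PiE_iff)
  qed
  then have "emeasure (exp_meas n r) {x \<in> space (exp_meas n r). round_up_vec n h x = p}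
     = (\<Prod>i\<in>{1..n}. emeasure (density lborel (exponential_density (r i))) {p i - h<..p i})"
    by (simp add: exp_meas_def E.emeasure_PiM)
  also have "\<dots> = (\<Prod>i\<in>{1..n}. ennreal (exp (- (r i * p i)) * (exp (r i * h) - 1)))"
  proof (rule prod.cong[OF refl])
    fix i assume i: "i \<in> {1..n}"
    have "p i \<in> grid h" using p(1) i by (auto simp: PiE_iff)
    then obtain k :: int where k: "p i = h * of_int k" by (auto simp: grid_def)
    \<comment> \<open>A positive lattice point is at least \<open>h\<close>, so its cell lies in the positive half-line.\<close>
    have "0 < k" using p(2)[OF i] h by (simp add: k zero_less_mult_iff)
    then have "h * 1 \<le> h * of_int k" using h by (intro mult_left_mono) auto
    then have "h \<le> p i" by (simp add: k)
    then have "emeasure (density lborel (exponential_density (r i))) {p i - h<..p i}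
        = ennreal (exp (- r i * (p i - h)) - exp (- r i * p i))"
      using h r by (intro emeasure_exponential_Ioc) auto
    also have "exp (- r i * (p i - h)) - exp (- r i * p i) = exp (- (r i * p i)) * (exp (r i * h) - 1)"
      by (simp add: algebra_simps flip: exp_add)
    finally show "emeasure (density lborel (exponential_density (r i))) {p i - h<..p i}
        = ennreal (exp (- (r i * p i)) * (exp (r i * h) - 1))" .
  qed
  also have "\<dots> = ennreal (\<Prod>i\<in>{1..n}. exp (- (r i * p i)) * (exp (r i * h) - 1))"
    using r h by (intro prod_ennreal) (simp add: less_imp_le)
  also have "(\<Prod>i\<in>{1..n}. exp (- (r i * p i)) * (exp (r i * h) - 1))
      = exp (- (\<Sum>i\<in>{1..n}. r i * p i)) * (\<Prod>i\<in>{1..n}. exp (r i * h) - 1)"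
    by (simp add: prod.distrib exp_sum flip: sum_negf)
  finally show ?thesis .
qed

section \<open>Tropical bijections preserve exponential laws\<close>

text \<open>
  Tropical functions of \<open>n\<close> variables: piecewise linear functions built from the coordinates with
  \<open>+\<close>, \<open>-\<close>, \<open>min\<close> and multiplication by integers. By induction they depend on the coordinates in
  \<open>{1..n}\<close> only, are continuous and measurable, and preserve every lattice \<open>grid h\<close>.
\<close>

inductive tropical :: "nat \<Rightarrow> ((nat \<Rightarrow> real) \<Rightarrow> real) \<Rightarrow> bool" for n where
  coord: "i \<in> {1..n} \<Longrightarrow> tropical n (\<lambda>t. t i)"
| zero: "tropical n (\<lambda>t. 0)"
| add: "tropical n f \<Longrightarrow> tropical n g \<Longrightarrow> tropical n (\<lambda>t. f t + g t)"
| diff: "tropical n f \<Longrightarrow> tropical n g \<Longrightarrow> tropical n (\<lambda>t. f t - g t)"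
| min: "tropical n f \<Longrightarrow> tropical n g \<Longrightarrow> tropical n (\<lambda>t. min (f t) (g t))"
| of_int_mult: "tropical n f \<Longrightarrow> tropical n (\<lambda>t. of_int k * f t)"

lemma tropical_numeral_mult: "tropical n f \<Longrightarrow> tropical n (\<lambda>t. numeral k * f t)"
  using tropical.of_int_mult[of n f "numeral k"] by simp

lemma tropical_cong:
  assumes "tropical n f" "\<And>i. i \<in> {1..n} \<Longrightarrow> t i = u i" shows "f t = f u"
  using assms by induction auto

lemma tropical_tendsto:
  assumes "tropical n f" "\<And>i. i \<in> {1..n} \<Longrightarrow> (\<lambda>k. X k i) \<longlonglongrightarrow> t i"
  shows "(\<lambda>k. f (X k)) \<longlonglongrightarrow> f t"
  using assms by induction (auto intro!: tendsto_intros tendsto_min)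

lemma tropical_measurable:
  assumes "tropical n f" shows "f \<in> borel_measurable (\<Pi>\<^sub>M i\<in>{1..n}. borel)"
  using assms by induction auto

lemma tropical_grid:
  assumes "tropical n f" "\<And>i. i \<in> {1..n} \<Longrightarrow> t i \<in> grid h" shows "f t \<in> grid h"
  using assms
proof induction
  case zero
  show ?case unfolding grid_def by (intro range_eqI[of _ _ 0]) simp
next
  case (add f g)
  then show ?case by (auto simp: grid_def simp flip: distrib_left of_int_add)
next
  case (diff f g)
  then show ?case by (auto simp: grid_def simp flip: right_diff_distrib of_int_diff)
next
  case (of_int_mult f k)
  then obtain l :: int where "f t = h * of_int l" by (auto simp: grid_def)
  then have "of_int k * f t = h * of_int (k * l)" by simp
  then show ?case unfolding grid_def by blast
qed (auto simp: min_def)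

text \<open>
  A tropical map \<open>T\<close> with a tropical inverse \<open>S\<close> on the open positive orthant of dimension \<open>n\<close>.
  The two maps need not be inverse to each other outside the orthant, and nothing is required of
  their values at indices outside \<open>{1..n}\<close>.
\<close>

locale tropical_bijection =
  fixes n :: nat and T S :: "(nat \<Rightarrow> real) \<Rightarrow> nat \<Rightarrow> real"
  assumes T: "\<And>i. i \<in> {1..n} \<Longrightarrow> tropical n (\<lambda>t. T t i)"
    and S: "\<And>i. i \<in> {1..n} \<Longrightarrow> tropical n (\<lambda>t. S t i)"
    and T_pos: "\<And>t i. \<forall>j\<in>{1..n}. 0 < t j \<Longrightarrow> i \<in> {1..n} \<Longrightarrow> 0 < T t i"
    and S_pos: "\<And>t i. \<forall>j\<in>{1..n}. 0 < t j \<Longrightarrow> i \<in> {1..n} \<Longrightarrow> 0 < S t i"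
    and ST: "\<And>t i. \<forall>j\<in>{1..n}. 0 < t j \<Longrightarrow> i \<in> {1..n} \<Longrightarrow> S (T t) i = t i"
    and TS: "\<And>t i. \<forall>j\<in>{1..n}. 0 < t j \<Longrightarrow> i \<in> {1..n} \<Longrightarrow> T (S t) i = t i"
begin

lemma T_cong: "(\<And>i. i \<in> {1..n} \<Longrightarrow> t i = u i) \<Longrightarrow> i \<in> {1..n} \<Longrightarrow> T t i = T u i"
  by (rule tropical_cong[OF T])

lemma S_cong: "(\<And>i. i \<in> {1..n} \<Longrightarrow> t i = u i) \<Longrightarrow> i \<in> {1..n} \<Longrightarrow> S t i = S u i"
  by (rule tropical_cong[OF S])

lemma T_measurable: "(\<lambda>x. \<lambda>i\<in>{1..n}. T x i) \<in> measurable (\<Pi>\<^sub>M i\<in>{1..n}. borel) (\<Pi>\<^sub>M i\<in>{1..n}. borel)"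
  by (intro measurable_restrict tropical_measurable T)

lemma T_round_up_vec_measurable:
  "(\<lambda>x. \<lambda>i\<in>{1..n}. T (round_up_vec n h x) i)
    \<in> measurable (exp_meas n r) (count_space (\<Pi>\<^sub>E i\<in>{1..n}. grid h))"
proof (rule measurable_compose[OF round_up_vec_measurable])
  have "(\<lambda>i\<in>{1..n}. T p i) \<in> (\<Pi>\<^sub>E i\<in>{1..n}. grid h)" if "p \<in> (\<Pi>\<^sub>E i\<in>{1..n}. grid h)" for p
    using that by (auto simp: PiE_iff intro!: tropical_grid[OF T])
  then show "(\<lambda>p. \<lambda>i\<in>{1..n}. T p i)
      \<in> measurable (count_space (\<Pi>\<^sub>E i\<in>{1..n}. grid h)) (count_space (\<Pi>\<^sub>E i\<in>{1..n}. grid h))"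
    by (auto simp: measurable_count_space_eq1)
qed

text \<open>
  The discrete form of the identity, exact at every mesh: \<open>T\<close> permutes the positive lattice vectors
  and carries the weight $\exp(-\sum_i r_i t_i)$ to $\exp(-\sum_i s_i p_i)$. The products in the
  hypothesis \<open>rates\<close> are the normalising constants of the two geometric laws.
\<close>

lemma distr_round_up:
  fixes r s :: "nat \<Rightarrow> real"
  assumes r: "\<And>i. 0 < r i" and s: "\<And>i. 0 < s i" and h: "0 < h"
    and balance: "\<And>t. (\<Sum>i\<in>{1..n}. r i * t i) = (\<Sum>i\<in>{1..n}. s i * T t i)"
    and rates: "(\<Prod>i\<in>{1..n}. exp (r i * h) - 1) = (\<Prod>i\<in>{1..n}. exp (s i * h) - 1)"
  shows "distr (exp_meas n r) (count_space (\<Pi>\<^sub>E i\<in>{1..n}. grid h)) (\<lambda>x. \<lambda>i\<in>{1..n}. T (round_up_vec n h x) i)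
       = distr (exp_meas n s) (count_space (\<Pi>\<^sub>E i\<in>{1..n}. grid h)) (round_up_vec n h)"
proof -
  let ?G = "\<Pi>\<^sub>E i\<in>{1..n}. grid h"
  have SG: "(\<lambda>i\<in>{1..n}. S p i) \<in> ?G" if "p \<in> ?G" for p
    using that by (auto simp: PiE_iff intro!: tropical_grid[OF S])
  note Dm = round_up_vec_measurable[of n h]
  note TDm = T_round_up_vec_measurable[of h]
  show "distr (exp_meas n r) (count_space ?G) (\<lambda>x. \<lambda>i\<in>{1..n}. T (round_up_vec n h x) i)
       = distr (exp_meas n s) (count_space ?G) (round_up_vec n h)"
  proof (rule measure_eqI_countable[OF _ _ countable_grid_vec])
    fix p assume p: "p \<in> ?G"
    have sing: "emeasure (distr (exp_meas n r) (count_space ?G) f) {p}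
        = emeasure (exp_meas n r) {x \<in> space (exp_meas n r). f x = p}"
      if "f \<in> measurable (exp_meas n r) (count_space ?G)" for f r
      using that p by (subst emeasure_distr) (auto intro!: arg_cong[where f = "emeasure _"])
    have meas: "{x \<in> space (exp_meas n r). f x = p} \<in> sets (exp_meas n r)"
      if "f \<in> measurable (exp_meas n r) (count_space ?G)" "p \<in> ?G" for f r p
    proof -
      have "f -` {p} \<inter> space (exp_meas n r) \<in> sets (exp_meas n r)"
        using that by (intro measurable_sets[OF that(1)]) auto
      also have "f -` {p} \<inter> space (exp_meas n r) = {x \<in> space (exp_meas n r). f x = p}" by auto
      finally show ?thesis .
    qed
    have Dpos: "\<forall>i\<in>{1..n}. 0 < round_up_vec n h x i" if "\<forall>i\<in>{1..n}. 0 < x i" for x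
      using that round_up_bounds(1)[OF h] by (auto simp: round_up_vec_def intro: less_le_trans)
    show "emeasure (distr (exp_meas n r) (count_space ?G) (\<lambda>x. \<lambda>i\<in>{1..n}. T (round_up_vec n h x) i)) {p}
        = emeasure (distr (exp_meas n s) (count_space ?G) (round_up_vec n h)) {p}"
    proof (cases "\<forall>i\<in>{1..n}. 0 < p i")
      case True
      \<comment> \<open>The only positive lattice vector mapped to \<open>p\<close> by \<open>T\<close>.\<close>
      define q where "q = (\<lambda>i\<in>{1..n}. S p i)"
      have q: "q \<in> ?G" using SG[OF p] by (simp add: q_def)
      have q_pos: "0 < q i" if "i \<in> {1..n}" for i using S_pos[OF True] that by (simp add: q_def)
      have Tq: "T q i = p i" if "i \<in> {1..n}" for i
        using T_cong[of q "S p", OF _ that] TS[OF True that] by (simp add: q_def)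
      have iff: "(\<lambda>i\<in>{1..n}. T (round_up_vec n h x) i) = p \<longleftrightarrow> round_up_vec n h x = q" if x: "\<forall>i\<in>{1..n}. 0 < x i" for x
      proof
        assume eq: "(\<lambda>i\<in>{1..n}. T (round_up_vec n h x) i) = p"
        have "round_up_vec n h x i = q i" if i: "i \<in> {1..n}" for i
        proof -
          have "round_up_vec n h x i = S (T (round_up_vec n h x)) i" using ST[OF Dpos[OF x] i] by simp
          also have "\<dots> = S p i" by (rule S_cong[OF _ i]) (simp flip: eq)
          finally show ?thesis using i by (simp add: q_def)
        qed
        then show "round_up_vec n h x = q" by (auto simp: round_up_vec_def q_def fun_eq_iff)
      next
        assume "round_up_vec n h x = q"
        then show "(\<lambda>i\<in>{1..n}. T (round_up_vec n h x) i) = p"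
          using Tq p by (simp only:) (auto simp: fun_eq_iff PiE_iff extensional_def)
      qed
      have "emeasure (exp_meas n r) {x \<in> space (exp_meas n r). (\<lambda>i\<in>{1..n}. T (round_up_vec n h x) i) = p}
          = emeasure (exp_meas n r) {x \<in> space (exp_meas n r). round_up_vec n h x = q}"
        using AE_exp_meas_pos[of r n, OF r] iff
        by (intro emeasure_eq_AE meas TDm Dm p q) (auto elim!: eventually_mono)
      also have "\<dots> = ennreal (exp (- (\<Sum>i\<in>{1..n}. r i * q i)) * (\<Prod>i\<in>{1..n}. exp (r i * h) - 1))"
        using q q_pos by (intro emeasure_round_up_vec r h) auto
      also have "\<dots> = ennreal (exp (- (\<Sum>i\<in>{1..n}. s i * p i)) * (\<Prod>i\<in>{1..n}. exp (s i * h) - 1))"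
        using Tq by (simp add: balance[of q] rates del: One_nat_def)
      also have "\<dots> = emeasure (exp_meas n s) {x \<in> space (exp_meas n s). round_up_vec n h x = p}"
        using p True by (intro emeasure_round_up_vec[symmetric] s h) auto
      finally show ?thesis by (simp only: sing[OF TDm] sing[OF Dm])
    next
      case False
      \<comment> \<open>Both laws are carried by the positive orthant.\<close>
      have TDpos: "0 < T (round_up_vec n h x) i" if "\<forall>i\<in>{1..n}. 0 < x i" "i \<in> {1..n}" for x i
        using T_pos[OF Dpos[OF that(1)] that(2)] .
      have "emeasure (exp_meas n r) {x \<in> space (exp_meas n r). (\<lambda>i\<in>{1..n}. T (round_up_vec n h x) i) = p}
          = emeasure (exp_meas n r) {}"
        using AE_exp_meas_pos[of r n, OF r] False TDpos
        by (intro emeasure_eq_AE meas TDm p) (auto elim!: eventually_mono)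
      moreover have "emeasure (exp_meas n s) {x \<in> space (exp_meas n s). round_up_vec n h x = p}
          = emeasure (exp_meas n s) {}"
        using AE_exp_meas_pos[of s n, OF s] False Dpos
        by (intro emeasure_eq_AE meas Dm p) (auto elim!: eventually_mono)
      ultimately show ?thesis by (simp only: sing[OF TDm] sing[OF Dm] emeasure_empty)
    qed
  qed auto
qed

text \<open>
  Letting the mesh tend to \<open>0\<close> turns the identity between geometric laws into the one between
  exponential laws, by continuity of \<open>T\<close> and dominated convergence.
\<close>

lemma distr_exp_meas:
  assumes r: "\<And>i. 0 < r i" and s: "\<And>i. 0 < s i"
    and balance: "\<And>t. (\<Sum>i\<in>{1..n}. r i * t i) = (\<Sum>i\<in>{1..n}. s i * T t i)"
    and rates: "\<And>h. (\<Prod>i\<in>{1..n}. exp (r i * h) - 1) = (\<Prod>i\<in>{1..n}. exp (s i * h) - 1)"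
  shows "distr (exp_meas n r) (\<Pi>\<^sub>M i\<in>{1..n}. borel) (\<lambda>x. \<lambda>i\<in>{1..n}. T x i) = exp_meas n s"
proof -
  interpret r: prob_space "exp_meas n r" by (rule prob_space_exp_meas) (rule r)
  interpret s: prob_space "exp_meas n s" by (rule prob_space_exp_meas) (rule s)
  have Tm: "(\<lambda>x. \<lambda>i\<in>{1..n}. T x i) \<in> measurable (exp_meas n r) (\<Pi>\<^sub>M i\<in>{1..n}. borel)"
    using T_measurable measurable_cong_sets[OF sets_exp_meas refl] by blast
  have Dlim: "(\<lambda>k. round_up_vec n (1 / real (Suc k)) x i) \<longlonglongrightarrow> x i" if "i \<in> {1..n}" for x i
    using that round_up_tendsto[of "x i"] by (simp add: round_up_vec_def del: of_nat_Suc)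
  show ?thesis
  proof (rule measure_eqI_bump)
    fix c m
    let ?f = "bump n c m"
    define h where "h k = 1 / real (Suc k)" for k
    have h: "0 < h k" for k by (simp add: h_def)
    let ?G = "\<lambda>k. \<Pi>\<^sub>E i\<in>{1..n}. grid (h k)"
    note Dm = round_up_vec_measurable[of n "h k" for k]
    note TDm = T_round_up_vec_measurable[of "h k" for k]
    have eq: "(\<integral>x. ?f (T (round_up_vec n (h k) x)) \<partial>exp_meas n r) = (\<integral>y. ?f (round_up_vec n (h k) y) \<partial>exp_meas n s)" for k
    proof -
      have "(\<integral>x. ?f (T (round_up_vec n (h k) x)) \<partial>exp_meas n r)
          = (\<integral>p. ?f p \<partial>distr (exp_meas n r) (count_space (?G k)) (\<lambda>x. \<lambda>i\<in>{1..n}. T (round_up_vec n (h k) x) i))"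
        by (subst integral_distr[OF TDm]) (simp_all add: bump_restrict del: One_nat_def)
      also have "\<dots> = (\<integral>p. ?f p \<partial>distr (exp_meas n s) (count_space (?G k)) (round_up_vec n (h k)))"
        by (simp only: distr_round_up[OF r s h balance rates])
      also have "\<dots> = (\<integral>y. ?f (round_up_vec n (h k) y) \<partial>exp_meas n s)"
        by (subst integral_distr[OF Dm]) simp_all
      finally show ?thesis .
    qed
    have "(\<lambda>k. \<integral>x. ?f (T (round_up_vec n (h k) x)) \<partial>exp_meas n r) \<longlonglongrightarrow> (\<integral>x. ?f (T x) \<partial>exp_meas n r)"
    proof (rule integral_dominated_convergence[where w = "\<lambda>_. 1"])
      show "AE x in exp_meas n r. (\<lambda>k. ?f (T (round_up_vec n (h k) x))) \<longlonglongrightarrow> ?f (T x)"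
        unfolding h_def by (intro AE_I2 bump_tendsto tropical_tendsto[OF T] Dlim)
      have "?f \<circ> (\<lambda>x. \<lambda>i\<in>{1..n}. T x i) \<in> borel_measurable (exp_meas n r)"
        by (rule measurable_comp[OF Tm bump_measurable])
      then show "(\<lambda>x. ?f (T x)) \<in> borel_measurable (exp_meas n r)"
        by (simp add: comp_def bump_restrict del: One_nat_def)
      have "?f \<circ> (\<lambda>x. \<lambda>i\<in>{1..n}. T (round_up_vec n (h k) x) i) \<in> borel_measurable (exp_meas n r)" for k
        by (rule measurable_comp[OF TDm]) simp
      then show "(\<lambda>x. ?f (T (round_up_vec n (h k) x))) \<in> borel_measurable (exp_meas n r)" for k
        by (simp add: comp_def bump_restrict del: One_nat_def)
    qed (simp_all add: bump_bounds)
    moreover have "(\<lambda>k. \<integral>y. ?f (round_up_vec n (h k) y) \<partial>exp_meas n s) \<longlonglongrightarrow> (\<integral>y. ?f y \<partial>exp_meas n s)"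
    proof (rule integral_dominated_convergence[where w = "\<lambda>_. 1"])
      show "AE y in exp_meas n s. (\<lambda>k. ?f (round_up_vec n (h k) y)) \<longlonglongrightarrow> ?f y"
        unfolding h_def by (intro AE_I2 bump_tendsto Dlim)
      show "(\<lambda>y. ?f y) \<in> borel_measurable (exp_meas n s)"
        using bump_measurable measurable_cong_sets[OF sets_exp_meas refl] by blast
      have "?f \<circ> round_up_vec n (h k) \<in> borel_measurable (exp_meas n s)" for k
        by (rule measurable_comp[OF Dm]) simp
      then show "(\<lambda>y. ?f (round_up_vec n (h k) y)) \<in> borel_measurable (exp_meas n s)" for k
        by (simp add: comp_def)
    qed (simp_all add: bump_bounds)
    ultimately have "(\<integral>x. ?f (T x) \<partial>exp_meas n r) = (\<integral>y. ?f y \<partial>exp_meas n s)"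
      unfolding eq by (rule LIMSEQ_unique)
    then show "(\<integral>x. ?f x \<partial>distr (exp_meas n r) (\<Pi>\<^sub>M i\<in>{1..n}. borel) (\<lambda>x. \<lambda>i\<in>{1..n}. T x i))
        = (\<integral>y. ?f y \<partial>exp_meas n s)"
      by (subst integral_distr[OF Tm bump_measurable]) (simp add: bump_restrict del: One_nat_def)
  qed (simp_all add: sets_exp_meas r.prob_space_distr[OF Tm] s.prob_space_axioms del: One_nat_def)
qed

end

lemma prod_tuple: "(\<Prod>i\<in>{1..length xs}. f (tuple xs i)) = prod_mset (image_mset f (mset xs))"
proof -
  have "(\<Prod>i\<in>{1..length xs}. f (tuple xs i)) = (\<Prod>i<length xs. f (xs ! i))"
    by (rule prod.reindex_bij_witness[of _ Suc "\<lambda>i. i - 1"]) (auto simp: tuple_def)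
  also have "\<dots> = prod_list (map f xs)"
    by (simp add: prod.list_conv_set_nth atLeast0LessThan)
  also have "\<dots> = prod_mset (image_mset f (mset xs))"
    by (simp flip: prod_mset_prod_list)
  finally show ?thesis .
qed

text \<open>
  The rates of \<open>exp_law\<close> as a function on \<open>nat\<close>, with the default value \<open>1\<close> outside the range
  of the list.
\<close>

definition rate :: "real list \<Rightarrow> nat \<Rightarrow> real" where
  "rate rs i = (if i \<in> {1..length rs} then tuple rs i else 1)"

lemma rate_pos: "\<forall>r\<in>set rs. 0 < r \<Longrightarrow> 0 < rate rs i"
  by (auto simp: rate_def tuple_def)

lemma exp_law_eq_exp_meas: "exp_law rs = exp_meas (length rs) (rate rs)"
  unfolding exp_law_def exp_meas_def by (intro PiM_cong) (auto simp: rate_def)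

context tropical_bijection
begin

lemma distr_exp_law:
  assumes len: "length as = n" "length bs = n" and pos: "\<forall>a\<in>set as. 0 < a"
    and mset: "mset as = mset bs"
    and balance: "\<And>t. (\<Sum>i\<in>{1..n}. tuple as i * t i) = (\<Sum>i\<in>{1..n}. tuple bs i * T t i)"
  shows "distr (exp_law as) (\<Pi>\<^sub>M i\<in>{1..n}. borel) (\<lambda>x. \<lambda>i\<in>{1..n}. T x i) = exp_law bs"
proof -
  have pos': "\<forall>b\<in>set bs. 0 < b" using pos mset by (metis mset_eq_setD)
  have rate: "rate as i = tuple as i" "rate bs i = tuple bs i" if "i \<in> {1..n}" for i
    using that len by (auto simp: rate_def)
  have "(\<Prod>i\<in>{1..n}. exp (rate cs i * h) - 1) = (\<Prod>r\<in>#mset cs. exp (r * h) - 1)"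
    if "length cs = n" for cs h
    unfolding that[symmetric] prod_tuple[of "\<lambda>r. exp (r * h) - 1" cs, symmetric]
    by (intro prod.cong) (auto simp: rate_def)
  then have rates: "(\<Prod>i\<in>{1..n}. exp (rate as i * h) - 1) = (\<Prod>i\<in>{1..n}. exp (rate bs i * h) - 1)" for h
    using len mset by metis
  have "(\<Sum>i\<in>{1..n}. rate as i * t i) = (\<Sum>i\<in>{1..n}. rate bs i * T t i)" for t
    using balance[of t] rate by (metis (no_types, lifting) sum.cong)
  from distr_exp_meas[OF rate_pos[OF pos] rate_pos[OF pos'] this rates]
  show ?thesis
    by (simp only: exp_law_eq_exp_meas len)
qed

lemma distr_inverse:
  assumes sets: "sets N = sets (\<Pi>\<^sub>M i\<in>{1..n}. borel)" and pos: "AE x in N. \<forall>i\<in>{1..n}. 0 < x i"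
  shows "distr (distr N (\<Pi>\<^sub>M i\<in>{1..n}. borel) (\<lambda>x. \<lambda>i\<in>{1..n}. T x i)) (\<Pi>\<^sub>M i\<in>{1..n}. borel)
      (\<lambda>x. \<lambda>i\<in>{1..n}. S x i) = N"
proof -
  let ?B = "\<Pi>\<^sub>M i\<in>{1..n}. borel :: real measure"
  have Tm: "(\<lambda>x. \<lambda>i\<in>{1..n}. T x i) \<in> measurable N ?B"
    using T_measurable measurable_cong_sets[OF sets refl] by blast
  have Sm: "(\<lambda>x. \<lambda>i\<in>{1..n}. S x i) \<in> measurable ?B ?B"
    by (intro measurable_restrict tropical_measurable S)
  have "distr (distr N ?B (\<lambda>x. \<lambda>i\<in>{1..n}. T x i)) ?B (\<lambda>x. \<lambda>i\<in>{1..n}. S x i)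
      = distr N ?B ((\<lambda>x. \<lambda>i\<in>{1..n}. S x i) \<circ> (\<lambda>x. \<lambda>i\<in>{1..n}. T x i))"
    by (rule distr_distr[OF Sm Tm])
  also have "\<dots> = distr N ?B (\<lambda>x. x)"
  proof (rule distr_cong_AE)
    show "AE x in N. ((\<lambda>x. \<lambda>i\<in>{1..n}. S x i) \<circ> (\<lambda>x. \<lambda>i\<in>{1..n}. T x i)) x = x"
      using pos AE_space
    proof eventually_elim
      case (elim x)
      have "S (\<lambda>i\<in>{1..n}. T x i) i = x i" if "i \<in> {1..n}" for i
        using S_cong[of "\<lambda>i\<in>{1..n}. T x i" "T x", OF _ that] ST[OF elim(1) that] by simp
      moreover have "x \<in> extensional {1..n}"
        using elim(2) sets_eq_imp_space_eq[OF sets] by (auto simp: space_PiM PiE_def)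
      ultimately show ?case by (auto simp: fun_eq_iff extensional_def)
    qed
    show "(\<lambda>x. x) \<in> measurable N ?B" by (rule measurable_ident_sets) (rule sets)
  qed (use measurable_comp[OF Tm Sm] in auto)
  also have "\<dots> = N" by (rule distr_id2) (rule sets[symmetric])
  finally show ?thesis .
qed

text \<open>
  The forward implication pushes the law of \<open>t\<close> through \<open>T\<close>. For the converse, both the law of
  \<open>t\<close> and the exponential law are recovered from their images under \<open>T\<close> by the inverse \<open>S\<close>.
\<close>

lemma law_iff:
  assumes M: "prob_space M" and t: "random_vector M n t" and t_pos: "positive_coordinates M n t"
    and len: "length as = n" "length bs = n" and pos: "\<forall>a\<in>set as. 0 < a"
    and mset: "mset as = mset bs"
    and balance: "\<And>t. (\<Sum>i\<in>{1..n}. tuple as i * t i) = (\<Sum>i\<in>{1..n}. tuple bs i * T t i)"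
  shows "law M n t = exp_law as \<longleftrightarrow> law M n (\<lambda>\<omega>. T (t \<omega>)) = exp_law bs"
proof -
  let ?B = "\<Pi>\<^sub>M i\<in>{1..n}. borel :: real measure"
  let ?T = "\<lambda>N. distr N ?B (\<lambda>x. \<lambda>i\<in>{1..n}. T x i)"
  have tm: "(\<lambda>\<omega>. \<lambda>i\<in>{1..n}. t \<omega> i) \<in> measurable M ?B"
    using t by (intro measurable_restrict) (auto simp: random_vector_def)
  have "?T (law M n t) = distr M ?B ((\<lambda>x. \<lambda>i\<in>{1..n}. T x i) \<circ> (\<lambda>\<omega>. \<lambda>i\<in>{1..n}. t \<omega> i))"
    unfolding law_def by (rule distr_distr[OF T_measurable tm])
  also have "(\<lambda>x. \<lambda>i\<in>{1..n}. T x i) \<circ> (\<lambda>\<omega>. \<lambda>i\<in>{1..n}. t \<omega> i) = (\<lambda>\<omega>. \<lambda>i\<in>{1..n}. T (t \<omega>) i)"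
    by (auto simp: fun_eq_iff restrict_def intro!: T_cong)
  finally have law: "law M n (\<lambda>\<omega>. T (t \<omega>)) = ?T (law M n t)" by (simp only: law_def)
  have AE_pos: "AE \<omega> in M. \<forall>i\<in>{1..n}. 0 < t \<omega> i"
    using t_pos by (intro AE_ball_countable[THEN iffD2]) (auto simp: positive_coordinates_def)
  have "AE x in law M n t. \<forall>i\<in>{1..n}. 0 < x i"
    unfolding law_def
  proof (subst AE_distr_iff[OF tm])
    show "{x \<in> space ?B. \<forall>i\<in>{1..n}. 0 < x i} \<in> sets ?B" by measurable
    show "AE \<omega> in M. \<forall>i\<in>{1..n}. 0 < (\<lambda>i\<in>{1..n}. t \<omega> i) i"
      using AE_pos by (simp del: One_nat_def)
  qed
  then have inv_law: "distr (?T (law M n t)) ?B (\<lambda>x. \<lambda>i\<in>{1..n}. S x i) = law M n t"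
    by (intro distr_inverse) (simp_all only: law_def sets_distr)
  have inv_exp: "distr (?T (exp_law as)) ?B (\<lambda>x. \<lambda>i\<in>{1..n}. S x i) = exp_law as"
    unfolding exp_law_eq_exp_meas len
    by (intro distr_inverse sets_exp_meas AE_exp_meas_pos rate_pos pos)
  show ?thesis
    using inv_law inv_exp distr_exp_law[OF len pos mset balance] law by metis
qed

end

section \<open>Minima along paths and the fans of linearity\<close>

text \<open>
  The minimum of the partial sums $0, x_1, x_1 + x_2, \dots$ of a list. For each root system the
  polynomials $\pi_k$ are a linear form plus such a minimum, taken along a path whose steps are
  multiples of the differences $t_n - t_{n-2}, \; t_{n-1} - t_{n-3}, \; \dots, \; t_3 - t_1$.
\<close>

fun path_min :: "real list \<Rightarrow> real" where
  "path_min [] = 0"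
| "path_min (x # xs) = min 0 (x + path_min xs)"

declare path_min.simps [simp del]

lemma path_min_eqI2:
  assumes "e = 0 \<or> e = a \<or> e = a + b" and "e \<le> 0" "e \<le> a" "e \<le> a + b"
  shows "path_min [a, b] = e"
  using assms unfolding path_min.simps by linarith

lemma path_min_eqI4:
  assumes "e = 0 \<or> e = a \<or> e = a + b \<or> e = a + b + c \<or> e = a + b + c + d"
    and "e \<le> 0" "e \<le> a" "e \<le> a + b" "e \<le> a + b + c" "e \<le> a + b + c + d"
  shows "path_min [a, b, c, d] = e"
  using assms unfolding path_min.simps by linarith

lemma path_min_le:
  "path_min [a, b, c, d] \<le> 0" "path_min [a, b, c, d] \<le> a" "path_min [a, b, c, d] \<le> a + b"
  "path_min [a, b, c, d] \<le> a + b + c" "path_min [a, b, c, d] \<le> a + b + c + d"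
  by (simp_all add: path_min.simps min_def)

lemma path_min_greatest:
  assumes "e \<le> 0" "e \<le> a" "e \<le> a + b" "e \<le> a + b + c" "e \<le> a + b + c + d"
  shows "e \<le> path_min [a, b, c, d]"
  using assms unfolding path_min.simps by linarith

text \<open>
  In types $B_2$ and $C_2$ put $x = t_4 - t_2$ and $y = t_3 - t_1$, and let \<open>x'\<close>, \<open>y'\<close> be the same
  differences for the reversed vector $(p_4, \dots, p_1)$. The plane of \<open>(x, y)\<close> is the union of four
  cones on which all minima are linear.
\<close>

lemma B2_fan:
  fixes x y m1 m2 x' y' :: real
  assumes m: "m1 = path_min [x, y]" "m2 = path_min [x, 2*y]"
    and xy': "x' = x + 2*y - 2*m1" "y' = m2 - y"
  shows "path_min [x', y'] = m2 - m1 \<and> path_min [x', 2*y'] = m2"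
proof -
  consider "0 \<le> x" "0 \<le> x + 2*y" | "x \<le> 0" "0 \<le> y" | "x + 2*y \<le> 0" "0 \<le> x + y" | "x + y \<le> 0" "y \<le> 0"
    by linarith
  then show ?thesis
  proof cases
    case 1
    then have "m1 = 0" "m2 = 0" unfolding m by (intro path_min_eqI2; linarith)+
    then show ?thesis using 1 xy' by (intro conjI path_min_eqI2; linarith)
  next
    case 2
    then have "m1 = x" "m2 = x" unfolding m by (intro path_min_eqI2; linarith)+
    then show ?thesis using 2 xy' by (intro conjI path_min_eqI2; linarith)
  next
    case 3
    then have "m1 = 0" "m2 = x + 2*y" unfolding m by (intro path_min_eqI2; linarith)+
    then show ?thesis using 3 xy' by (intro conjI path_min_eqI2; linarith)
  next
    case 4
    then have "m1 = x + y" "m2 = x + 2*y" unfolding m by (intro path_min_eqI2; linarith)+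
    then show ?thesis using 4 xy' by (intro conjI path_min_eqI2; linarith)
  qed
qed

lemma C2_fan:
  fixes x y m1 m2 x' y' :: real
  assumes m: "m1 = path_min [x, y]" "m2 = path_min [2*x, y]"
    and xy': "x' = x + y - m2" "y' = 2*m1 - y"
  shows "path_min [x', y'] = m1 \<and> path_min [2*x', y'] = 2*m1 - m2"
proof -
  consider "0 \<le> x" "0 \<le> x + y" | "x \<le> 0" "0 \<le> y" | "x + y \<le> 0" "0 \<le> 2*x + y" | "2*x + y \<le> 0" "y \<le> 0"
    by linarith
  then show ?thesis
  proof cases
    case 1
    then have "m1 = 0" "m2 = 0" unfolding m by (intro path_min_eqI2; linarith)+
    then show ?thesis using 1 xy' by (intro conjI path_min_eqI2; linarith)
  next
    case 2
    then have "m1 = x" "m2 = 2*x" unfolding m by (intro path_min_eqI2; linarith)+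
    then show ?thesis using 2 xy' by (intro conjI path_min_eqI2; linarith)
  next
    case 3
    then have "m1 = x + y" "m2 = 0" unfolding m by (intro path_min_eqI2; linarith)+
    then show ?thesis using 3 xy' by (intro conjI path_min_eqI2; linarith)
  next
    case 4
    then have "m1 = x + y" "m2 = 2*x + y" unfolding m by (intro path_min_eqI2; linarith)+
    then show ?thesis using 4 xy' by (intro conjI path_min_eqI2; linarith)
  qed
qed

text \<open>
  In type $G_2$ put $x = t_6 - t_4$, $y = t_5 - t_3$, $z = t_4 - t_2$, $w = t_3 - t_1$. The space of
  \<open>(x, y, z, w)\<close> is the union of sixteen simplicial cones, one for each rule, on which the four
  minima of the lemma \<open>G2_cone_path_min\<close> are linear. The predicate states that the point lies in one
  of the cones and that \<open>m1\<close>, \<open>\<dots>\<close>, \<open>m4\<close> are the values of the minima. Each rule lists the four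
  facets of its cone; the digits in its name say which partial sum, counted from \<open>0\<close>, attains each
  of the four minima.
\<close>

inductive G2_cone :: "real \<Rightarrow> real \<Rightarrow> real \<Rightarrow> real \<Rightarrow> real \<Rightarrow> real \<Rightarrow> real \<Rightarrow> real \<Rightarrow> bool"
  for x y z w m1 m2 m3 m4 where
  r0000: "0 \<le> x \<Longrightarrow> 0 \<le> x + 3*y \<Longrightarrow> 0 \<le> x + 3*y + 2*z \<Longrightarrow> 0 \<le> x + 3*y + 2*z + 3*w \<Longrightarrow>
     m1 = 0 \<Longrightarrow> m2 = 0 \<Longrightarrow> m3 = 0 \<Longrightarrow> m4 = 0 \<Longrightarrow> G2_cone x y z w m1 m2 m3 m4"
| r0040: "x + 3*y + 2*z + 3*w \<le> 0 \<Longrightarrow> 0 \<le> x \<Longrightarrow> 0 \<le> x + 3*y \<Longrightarrow> 0 \<le> x + 3*y + 2*z + 2*w \<Longrightarrow>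
     m1 = 0 \<Longrightarrow> m2 = 0 \<Longrightarrow> m3 = x + 3*y + 2*z + 3*w \<Longrightarrow> m4 = 0 \<Longrightarrow> G2_cone x y z w m1 m2 m3 m4"
| r0222: "x + 3*y \<le> 0 \<Longrightarrow> 0 \<le> z \<Longrightarrow> 0 \<le> 2*z + 3*w \<Longrightarrow> 0 \<le> x + 2*y \<Longrightarrow>
     m1 = 0 \<Longrightarrow> m2 = x + 3*y \<Longrightarrow> m3 = x + 3*y \<Longrightarrow> m4 = 2*x + 6*y \<Longrightarrow> G2_cone x y z w m1 m2 m3 m4"
| r0242: "x + 3*y \<le> 0 \<Longrightarrow> 2*z + 3*w \<le> 0 \<Longrightarrow> 0 \<le> z + w \<Longrightarrow> 0 \<le> x + 2*y \<Longrightarrow>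
     m1 = 0 \<Longrightarrow> m2 = x + 3*y \<Longrightarrow> m3 = x + 3*y + 2*z + 3*w \<Longrightarrow> m4 = 2*x + 6*y \<Longrightarrow> G2_cone x y z w m1 m2 m3 m4"
| r0330: "x + 3*y + 2*z \<le> 0 \<Longrightarrow> 0 \<le> w \<Longrightarrow> 0 \<le> x \<Longrightarrow> 0 \<le> 2*x + 6*y + 3*z \<Longrightarrow>
     m1 = 0 \<Longrightarrow> m2 = x + 3*y + 2*z \<Longrightarrow> m3 = x + 3*y + 2*z \<Longrightarrow> m4 = 0 \<Longrightarrow> G2_cone x y z w m1 m2 m3 m4"
| r0333: "2*x + 6*y + 3*z \<le> 0 \<Longrightarrow> z \<le> 0 \<Longrightarrow> 0 \<le> w \<Longrightarrow> 0 \<le> x + 2*y + z \<Longrightarrow>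
     m1 = 0 \<Longrightarrow> m2 = x + 3*y + 2*z \<Longrightarrow> m3 = x + 3*y + 2*z \<Longrightarrow> m4 = 2*x + 6*y + 3*z \<Longrightarrow> G2_cone x y z w m1 m2 m3 m4"
| r0440: "x + 3*y + 2*z + 2*w \<le> 0 \<Longrightarrow> w \<le> 0 \<Longrightarrow> 0 \<le> x \<Longrightarrow> 0 \<le> 2*x + 6*y + 3*z + 3*w \<Longrightarrow>
     m1 = 0 \<Longrightarrow> m2 = x + 3*y + 2*z + 2*w \<Longrightarrow> m3 = x + 3*y + 2*z + 3*w \<Longrightarrow> m4 = 0 \<Longrightarrow> G2_cone x y z w m1 m2 m3 m4"
| r0444: "2*x + 6*y + 3*z + 3*w \<le> 0 \<Longrightarrow> z + w \<le> 0 \<Longrightarrow> w \<le> 0 \<Longrightarrow> 0 \<le> x + 2*y + z + w \<Longrightarrow>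
     m1 = 0 \<Longrightarrow> m2 = x + 3*y + 2*z + 2*w \<Longrightarrow> m3 = x + 3*y + 2*z + 3*w \<Longrightarrow> m4 = 2*x + 6*y + 3*z + 3*w \<Longrightarrow> G2_cone x y z w m1 m2 m3 m4"
| r1111: "x \<le> 0 \<Longrightarrow> 0 \<le> y \<Longrightarrow> 0 \<le> 3*y + 2*z \<Longrightarrow> 0 \<le> 3*y + 2*z + 3*w \<Longrightarrow>
     m1 = x \<Longrightarrow> m2 = x \<Longrightarrow> m3 = x \<Longrightarrow> m4 = 2*x \<Longrightarrow> G2_cone x y z w m1 m2 m3 m4"
| r1141: "x \<le> 0 \<Longrightarrow> 3*y + 2*z + 3*w \<le> 0 \<Longrightarrow> 0 \<le> y \<Longrightarrow> 0 \<le> 3*y + 2*z + 2*w \<Longrightarrow>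
     m1 = x \<Longrightarrow> m2 = x \<Longrightarrow> m3 = x + 3*y + 2*z + 3*w \<Longrightarrow> m4 = 2*x \<Longrightarrow> G2_cone x y z w m1 m2 m3 m4"
| r1331: "x \<le> 0 \<Longrightarrow> 3*y + 2*z \<le> 0 \<Longrightarrow> 0 \<le> w \<Longrightarrow> 0 \<le> 2*y + z \<Longrightarrow>
     m1 = x \<Longrightarrow> m2 = x + 3*y + 2*z \<Longrightarrow> m3 = x + 3*y + 2*z \<Longrightarrow> m4 = 2*x \<Longrightarrow> G2_cone x y z w m1 m2 m3 m4"
| r1441: "x \<le> 0 \<Longrightarrow> 3*y + 2*z + 2*w \<le> 0 \<Longrightarrow> w \<le> 0 \<Longrightarrow> 0 \<le> 2*y + z + w \<Longrightarrow>
     m1 = x \<Longrightarrow> m2 = x + 3*y + 2*z + 2*w \<Longrightarrow> m3 = x + 3*y + 2*z + 3*w \<Longrightarrow> m4 = 2*x \<Longrightarrow> G2_cone x y z w m1 m2 m3 m4"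
| r2222: "x + 2*y \<le> 0 \<Longrightarrow> y \<le> 0 \<Longrightarrow> 0 \<le> z \<Longrightarrow> 0 \<le> 2*z + 3*w \<Longrightarrow>
     m1 = x + 2*y \<Longrightarrow> m2 = x + 3*y \<Longrightarrow> m3 = x + 3*y \<Longrightarrow> m4 = 2*x + 6*y \<Longrightarrow> G2_cone x y z w m1 m2 m3 m4"
| r2242: "x + 2*y \<le> 0 \<Longrightarrow> y \<le> 0 \<Longrightarrow> 2*z + 3*w \<le> 0 \<Longrightarrow> 0 \<le> z + w \<Longrightarrow>
     m1 = x + 2*y \<Longrightarrow> m2 = x + 3*y \<Longrightarrow> m3 = x + 3*y + 2*z + 3*w \<Longrightarrow> m4 = 2*x + 6*y \<Longrightarrow> G2_cone x y z w m1 m2 m3 m4"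
| r3333: "x + 2*y + z \<le> 0 \<Longrightarrow> 2*y + z \<le> 0 \<Longrightarrow> z \<le> 0 \<Longrightarrow> 0 \<le> w \<Longrightarrow>
     m1 = x + 2*y + z \<Longrightarrow> m2 = x + 3*y + 2*z \<Longrightarrow> m3 = x + 3*y + 2*z \<Longrightarrow> m4 = 2*x + 6*y + 3*z \<Longrightarrow> G2_cone x y z w m1 m2 m3 m4"
| r4444: "x + 2*y + z + w \<le> 0 \<Longrightarrow> 2*y + z + w \<le> 0 \<Longrightarrow> z + w \<le> 0 \<Longrightarrow> w \<le> 0 \<Longrightarrow>
     m1 = x + 2*y + z + w \<Longrightarrow> m2 = x + 3*y + 2*z + 2*w \<Longrightarrow> m3 = x + 3*y + 2*z + 3*w \<Longrightarrow> m4 = 2*x + 6*y + 3*z + 3*w \<Longrightarrow> G2_cone x y z w m1 m2 m3 m4"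

lemma G2_cone_path_min:
  assumes "G2_cone x y z w m1 m2 m3 m4"
  shows "path_min [x, 2*y, z, w] = m1" "path_min [x, 3*y, 2*z, 2*w] = m2"
    "path_min [x, 3*y, 2*z, 3*w] = m3" "path_min [2*x, 6*y, 3*z, 3*w] = m4"
  using assms by (cases; intro path_min_eqI4; linarith)+

lemma G2_cone_exists: "\<exists>m1 m2 m3 m4. G2_cone x y z w m1 m2 m3 m4"
proof -
  have "(0 \<le> x \<and> 0 \<le> x + 3*y \<and> 0 \<le> x + 3*y + 2*z \<and> 0 \<le> x + 3*y + 2*z + 3*w) \<or>
    (x + 3*y + 2*z + 3*w \<le> 0 \<and> 0 \<le> x \<and> 0 \<le> x + 3*y \<and> 0 \<le> x + 3*y + 2*z + 2*w) \<or>
    (x + 3*y \<le> 0 \<and> 0 \<le> z \<and> 0 \<le> 2*z + 3*w \<and> 0 \<le> x + 2*y) \<or>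
    (x + 3*y \<le> 0 \<and> 2*z + 3*w \<le> 0 \<and> 0 \<le> z + w \<and> 0 \<le> x + 2*y) \<or>
    (x + 3*y + 2*z \<le> 0 \<and> 0 \<le> w \<and> 0 \<le> x \<and> 0 \<le> 2*x + 6*y + 3*z) \<or>
    (2*x + 6*y + 3*z \<le> 0 \<and> z \<le> 0 \<and> 0 \<le> w \<and> 0 \<le> x + 2*y + z) \<or>
    (x + 3*y + 2*z + 2*w \<le> 0 \<and> w \<le> 0 \<and> 0 \<le> x \<and> 0 \<le> 2*x + 6*y + 3*z + 3*w) \<or>
    (2*x + 6*y + 3*z + 3*w \<le> 0 \<and> z + w \<le> 0 \<and> w \<le> 0 \<and> 0 \<le> x + 2*y + z + w) \<or>
    (x \<le> 0 \<and> 0 \<le> y \<and> 0 \<le> 3*y + 2*z \<and> 0 \<le> 3*y + 2*z + 3*w) \<or>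
    (x \<le> 0 \<and> 3*y + 2*z + 3*w \<le> 0 \<and> 0 \<le> y \<and> 0 \<le> 3*y + 2*z + 2*w) \<or>
    (x \<le> 0 \<and> 3*y + 2*z \<le> 0 \<and> 0 \<le> w \<and> 0 \<le> 2*y + z) \<or>
    (x \<le> 0 \<and> 3*y + 2*z + 2*w \<le> 0 \<and> w \<le> 0 \<and> 0 \<le> 2*y + z + w) \<or>
    (x + 2*y \<le> 0 \<and> y \<le> 0 \<and> 0 \<le> z \<and> 0 \<le> 2*z + 3*w) \<or>
    (x + 2*y \<le> 0 \<and> y \<le> 0 \<and> 2*z + 3*w \<le> 0 \<and> 0 \<le> z + w) \<or>
    (x + 2*y + z \<le> 0 \<and> 2*y + z \<le> 0 \<and> z \<le> 0 \<and> 0 \<le> w) \<or>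
    (x + 2*y + z + w \<le> 0 \<and> 2*y + z + w \<le> 0 \<and> z + w \<le> 0 \<and> w \<le> 0)"
    by (smt (verit))
  then show ?thesis
    by (elim disjE conjE) (blast intro: G2_cone.intros refl)+
qed

text \<open>
  The point \<open>(x', y', z', w')\<close> collects the differences of the reversed vector $(p_6, \dots, p_1)$.
  The map that it defines permutes the sixteen cones, and the equations for \<open>n1\<close>, \<open>\<dots>\<close>, \<open>n4\<close> say
  that applying the change of parameters to the reversed vector gives back $(t_6, \dots, t_1)$.
\<close>

lemma G2_cone_involution:
  assumes "G2_cone x y z w m1 m2 m3 m4"
    and "x' = x + 3*y + 2*z + 3*w - 3*m2 + m4" "y' = m1 + m3 - m4 - w"
      "z' = 3*m2 - 3*m1 - m3 - z" "w' = m4 - m2 - y"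
    and "n1 = m3 - m2" "n2 = m3 - m1" "n3 = m3" "n4 = 2*m3 - m4"
  shows "G2_cone x' y' z' w' n1 n2 n3 n4"
  using assms(1)
proof cases
  case r0000
  show ?thesis by (rule G2_cone.r0000; use r0000(1-4) in \<open>simp add: assms(2-) r0000(5-8)\<close>)
next
  case r0040
  show ?thesis by (rule G2_cone.r1111; use r0040(1-4) in \<open>simp add: assms(2-) r0040(5-8)\<close>)
next
  case r0222
  show ?thesis by (rule G2_cone.r0330; use r0222(1-4) in \<open>simp add: assms(2-) r0222(5-8)\<close>)
next
  case r0242
  show ?thesis by (rule G2_cone.r1331; use r0242(1-4) in \<open>simp add: assms(2-) r0242(5-8)\<close>)
next
  case r0330
  show ?thesis by (rule G2_cone.r0222; use r0330(1-4) in \<open>simp add: assms(2-) r0330(5-8)\<close>)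
next
  case r0333
  show ?thesis by (rule G2_cone.r0333; use r0333(1-4) in \<open>simp add: assms(2-) r0333(5-8)\<close>)
next
  case r0440
  show ?thesis by (rule G2_cone.r2222; use r0440(1-4) in \<open>simp add: assms(2-) r0440(5-8)\<close>)
next
  case r0444
  show ?thesis by (rule G2_cone.r3333; use r0444(1-4) in \<open>simp add: assms(2-) r0444(5-8)\<close>)
next
  case r1111
  show ?thesis by (rule G2_cone.r0040; use r1111(1-4) in \<open>simp add: assms(2-) r1111(5-8)\<close>)
next
  case r1141
  show ?thesis by (rule G2_cone.r1141; use r1141(1-4) in \<open>simp add: assms(2-) r1141(5-8)\<close>)
next
  case r1331
  show ?thesis by (rule G2_cone.r0242; use r1331(1-4) in \<open>simp add: assms(2-) r1331(5-8)\<close>)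
next
  case r1441
  show ?thesis by (rule G2_cone.r2242; use r1441(1-4) in \<open>simp add: assms(2-) r1441(5-8)\<close>)
next
  case r2222
  show ?thesis by (rule G2_cone.r0440; use r2222(1-4) in \<open>simp add: assms(2-) r2222(5-8)\<close>)
next
  case r2242
  show ?thesis by (rule G2_cone.r1441; use r2242(1-4) in \<open>simp add: assms(2-) r2242(5-8)\<close>)
next
  case r3333
  show ?thesis by (rule G2_cone.r0444; use r3333(1-4) in \<open>simp add: assms(2-) r3333(5-8)\<close>)
next
  case r4444
  show ?thesis by (rule G2_cone.r4444; use r4444(1-4) in \<open>simp add: assms(2-) r4444(5-8)\<close>)
qed

text \<open>
  Positivity of the vector \<open>p\<close>, in the coordinates \<open>t1\<close>, \<open>t2\<close>, \<open>x\<close>, \<open>y\<close>, \<open>z\<close>, \<open>w\<close>; the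
  hypotheses say that $t_1, \dots, t_6$ are positive.
\<close>

lemma G2_cone_pos:
  assumes "G2_cone x y z w m1 m2 m3 m4"
    and "0 < t1" "0 < t2" "0 < t1 + w" "0 < t2 + z" "0 < t1 + w + y" "0 < t2 + z + x"
  shows "0 < t2 + x + 3*y + 2*z + 3*w - m3 \<and> 0 < t1 + m3 - m2 \<and> 0 < t2 + 3*m2 - m3 - m4 \<and>
    0 < t1 + w + m4 - m1 - m2 \<and> 0 < t2 + z + 3*m1 - m4 \<and> 0 < t1 + w + y - m1"
  using assms(1) by cases (use assms(2-) in \<open>simp_all\<close>)

text \<open>
  The next lemmas reduce the tropical polynomials of type $G_2$ to the minima along paths. All other
  monomials, in particular those containing \<open>G2_M\<close>, are redundant: each is a convex combination of
  the five monomials that remain.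
\<close>

lemma G2_M_cases:
  "G2_M t = t 1 + t 3 \<or> G2_M t = 2 * t 3 \<or> G2_M t = t 3 + t 5 \<or> G2_M t = t 1 + t 5"
proof -
  have "G2_M t \<in> {t 1 + t 3, 2 * t 3, t 3 + t 5, t 1 + t 5}"
    unfolding G2_M_def by (rule Min_in) simp_all
  then show ?thesis by blast
qed

lemma G2_pi1_eq:
  "G2_pi1 t = t 1 + t 2 + 2 * t 3 + t 4
     + path_min [t 6 - t 4, 2 * (t 5 - t 3), t 4 - t 2, t 3 - t 1]"
    (is "_ = ?b + ?m")
proof -
  define m where "m = ?m"
  have le: "m \<le> 0"
    "m \<le> t 6 - t 4"
    "m \<le> t 6 - t 4 + 2 * t 5 - 2 * t 3"
    "m \<le> t 6 - t 4 + 2 * t 5 - 2 * t 3 + t 4 - t 2"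
    "m \<le> t 6 - t 4 + 2 * t 5 - 2 * t 3 + t 4 - t 2 + t 3 - t 1"
    using path_min_le[of "t 6 - t 4" "2 * (t 5 - t 3)" "t 4 - t 2" "t 3 - t 1"]
    by (simp_all add: m_def right_diff_distrib)
  have ub: "G2_pi1 t \<le> t 1 + t 2 + 2 * t 3 + t 4"
    "G2_pi1 t \<le> t 1 + t 2 + 2 * min (t 3) (t 5) + t 6"
    "G2_pi1 t \<le> min (t 1) (t 3) + t 4 + 2 * t 5 + t 6"
    unfolding G2_pi1_def by (rule Min_le; simp)+
  have "G2_pi1 t = ?b + m"
  proof (rule antisym)
    have "G2_pi1 t - ?b \<le> m"
      unfolding m_def
      using ub min.cobounded1[of "t 3" "t 5"] min.cobounded2[of "t 3" "t 5"]
        min.cobounded1[of "t 1" "t 3"] min.cobounded2[of "t 1" "t 3"]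
      by (intro path_min_greatest; simp only: right_diff_distrib; linarith)
    then show "G2_pi1 t \<le> ?b + m" by linarith
  next
    show "?b + m \<le> G2_pi1 t"
      unfolding G2_pi1_def
    proof (rule Min.boundedI)
      fix y assume "y \<in> {t 1 + t 2 + 2 * t 3 + t 4,
          t 1 + t 2 + 2 * min (t 3) (t 5) + t 6,
          min (t 1) (t 3) + t 4 + 2 * t 5 + t 6}"
      then show "?b + m \<le> y"
        using le by (elim insertE emptyE; linarith)
    qed simp_all
  qed
  then show ?thesis by (simp only: m_def)
qed

lemma G2_pi2_eq:
  "G2_pi2 t = 2 * t 1 + 2 * t 2 + 3 * t 3 + t 4
     + path_min [t 6 - t 4, 3 * (t 5 - t 3), 2 * (t 4 - t 2), 2 * (t 3 - t 1)]"
    (is "_ = ?b + ?m")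
proof -
  define m where "m = ?m"
  have le: "m \<le> 0"
    "m \<le> t 6 - t 4"
    "m \<le> t 6 - t 4 + 3 * t 5 - 3 * t 3"
    "m \<le> t 6 - t 4 + 3 * t 5 - 3 * t 3 + 2 * t 4 - 2 * t 2"
    "m \<le> t 6 - t 4 + 3 * t 5 - 3 * t 3 + 2 * t 4 - 2 * t 2 + 2 * t 3 - 2 * t 1"
    using path_min_le[of "t 6 - t 4" "3 * (t 5 - t 3)" "2 * (t 4 - t 2)" "2 * (t 3 - t 1)"]
    by (simp_all add: m_def right_diff_distrib)
  have ub: "G2_pi2 t \<le> 2 * t 1 + 2 * t 2 + 3 * t 3 + t 4"
    "G2_pi2 t \<le> 2 * t 1 + 2 * t 2 + 3 * min (t 3) (t 5) + t 6"
    "G2_pi2 t \<le> 2 * min (t 1) (t 3) + 2 * t 4 + 3 * t 5 + t 6"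
    "G2_pi2 t \<le> t 1 + t 2 + t 4 + 2 * t 5 + t 6 + G2_M t"
    unfolding G2_pi2_def by (rule Min_le; simp)+
  have "G2_pi2 t = ?b + m"
  proof (rule antisym)
    have "G2_pi2 t - ?b \<le> m"
      unfolding m_def
      using ub min.cobounded1[of "t 3" "t 5"] min.cobounded2[of "t 3" "t 5"]
        min.cobounded1[of "t 1" "t 3"] min.cobounded2[of "t 1" "t 3"]
      by (intro path_min_greatest; simp only: right_diff_distrib; linarith)
    then show "G2_pi2 t \<le> ?b + m" by linarith
  next
    show "?b + m \<le> G2_pi2 t"
      unfolding G2_pi2_def
    proof (rule Min.boundedI)
      fix y assume "y \<in> {2 * t 1 + 2 * t 2 + 3 * t 3 + t 4,
          2 * t 1 + 2 * t 2 + 3 * min (t 3) (t 5) + t 6,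
          2 * min (t 1) (t 3) + 2 * t 4 + 3 * t 5 + t 6,
          t 1 + t 2 + t 4 + 2 * t 5 + t 6 + G2_M t}"
      then show "?b + m \<le> y"
        using le G2_M_cases[of t] by (elim insertE emptyE disjE; linarith)
    qed simp_all
  qed
  then show ?thesis by (simp only: m_def)
qed

lemma G2_pi3_eq:
  "G2_pi3 t = 3 * t 1 + 2 * t 2 + 3 * t 3 + t 4
     + path_min [t 6 - t 4, 3 * (t 5 - t 3), 2 * (t 4 - t 2), 3 * (t 3 - t 1)]"
    (is "_ = ?b + ?m")
proof -
  define m where "m = ?m"
  have le: "m \<le> 0"
    "m \<le> t 6 - t 4"
    "m \<le> t 6 - t 4 + 3 * t 5 - 3 * t 3"
    "m \<le> t 6 - t 4 + 3 * t 5 - 3 * t 3 + 2 * t 4 - 2 * t 2"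
    "m \<le> t 6 - t 4 + 3 * t 5 - 3 * t 3 + 2 * t 4 - 2 * t 2 + 3 * t 3 - 3 * t 1"
    using path_min_le[of "t 6 - t 4" "3 * (t 5 - t 3)" "2 * (t 4 - t 2)" "3 * (t 3 - t 1)"]
    by (simp_all add: m_def right_diff_distrib)
  have ub: "G2_pi3 t \<le> 3 * t 1 + 2 * t 2 + 3 * t 3 + t 4"
    "G2_pi3 t \<le> 3 * t 1 + 2 * t 2 + 3 * min (t 3) (t 5) + t 6"
    "G2_pi3 t \<le> 3 * min (t 1) (t 3) + 2 * t 4 + 3 * t 5 + t 6"
    "G2_pi3 t \<le> 2 * t 1 + t 2 + t 4 + 2 * t 5 + t 6 + G2_M t"
    unfolding G2_pi3_def by (rule Min_le; simp)+
  have "G2_pi3 t = ?b + m"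
  proof (rule antisym)
    have "G2_pi3 t - ?b \<le> m"
      unfolding m_def
      using ub min.cobounded1[of "t 3" "t 5"] min.cobounded2[of "t 3" "t 5"]
        min.cobounded1[of "t 1" "t 3"] min.cobounded2[of "t 1" "t 3"]
      by (intro path_min_greatest; simp only: right_diff_distrib; linarith)
    then show "G2_pi3 t \<le> ?b + m" by linarith
  next
    show "?b + m \<le> G2_pi3 t"
      unfolding G2_pi3_def
    proof (rule Min.boundedI)
      fix y assume "y \<in> {3 * t 1 + 2 * t 2 + 3 * t 3 + t 4,
          3 * t 1 + 2 * t 2 + 3 * min (t 3) (t 5) + t 6,
          3 * min (t 1) (t 3) + 2 * t 4 + 3 * t 5 + t 6,
          2 * t 1 + t 2 + t 4 + 2 * t 5 + t 6 + G2_M t}"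
      then show "?b + m \<le> y"
        using le G2_M_cases[of t] by (elim insertE emptyE disjE; linarith)
    qed simp_all
  qed
  then show ?thesis by (simp only: m_def)
qed

lemma G2_pi4_eq:
  "G2_pi4 t = 3 * t 1 + 3 * t 2 + 6 * t 3 + 2 * t 4
     + path_min [2 * (t 6 - t 4), 6 * (t 5 - t 3), 3 * (t 4 - t 2), 3 * (t 3 - t 1)]"
    (is "_ = ?b + ?m")
proof -
  define m where "m = ?m"
  have le: "m \<le> 0"
    "m \<le> 2 * t 6 - 2 * t 4"
    "m \<le> 2 * t 6 - 2 * t 4 + 6 * t 5 - 6 * t 3"
    "m \<le> 2 * t 6 - 2 * t 4 + 6 * t 5 - 6 * t 3 + 3 * t 4 - 3 * t 2"
    "m \<le> 2 * t 6 - 2 * t 4 + 6 * t 5 - 6 * t 3 + 3 * t 4 - 3 * t 2 + 3 * t 3 - 3 * t 1"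
    using path_min_le[of "2 * (t 6 - t 4)" "6 * (t 5 - t 3)" "3 * (t 4 - t 2)" "3 * (t 3 - t 1)"]
    by (simp_all add: m_def right_diff_distrib)
  define u where "u = min (t 1 + t 2 + 2 * min (t 3) (t 5)) (min (t 1) (t 3) + t 4 + 2 * t 5)"
  define c where "c = 2 * t 1 + 2 * t 2 + 3 * t 3 + t 4"
  let ?F = "{t 1 + t 2 + 3 * t 3 + t 4, t 1 + t 2 + 3 * min (t 3) (t 5) + t 6, G2_M t + t 4 + 2 * t 5 + t 6}"
  define v where "v = Min ?F"
  have pi4: "G2_pi4 t = min (c + v) (2 * t 6 + 3 * u)"
    by (simp only: G2_pi4_def u_def v_def c_def)
  have v: "v \<le> t 1 + t 2 + 3 * t 3 + t 4" "v \<le> t 1 + t 2 + 3 * min (t 3) (t 5) + t 6"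
    unfolding v_def by (rule Min_le; simp)+
  have u: "u \<le> t 1 + t 2 + 2 * min (t 3) (t 5)" "u \<le> min (t 1) (t 3) + t 4 + 2 * t 5"
    unfolding u_def by simp_all
  have ub: "G2_pi4 t \<le> c + v" "G2_pi4 t \<le> 2 * t 6 + 3 * u"
    unfolding pi4 by simp_all
  note ub = ub u v c_def
  have "G2_pi4 t = ?b + m"
  proof (rule antisym)
    have "G2_pi4 t - ?b \<le> m"
      unfolding m_def
      using ub min.cobounded1[of "t 3" "t 5"] min.cobounded2[of "t 3" "t 5"]
        min.cobounded1[of "t 1" "t 3"] min.cobounded2[of "t 1" "t 3"]
      by (intro path_min_greatest; simp only: right_diff_distrib; linarith)
    then show "G2_pi4 t \<le> ?b + m" by linarith
  next
    have "u = t 1 + t 2 + 2 * t 3 \<or> u = t 1 + t 2 + 2 * t 5 \<or> u = t 1 + t 4 + 2 * t 5 \<or> u = t 3 + t 4 + 2 * t 5"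
      unfolding u_def by linarith
    then have "?b + m \<le> 2 * t 6 + 3 * u"
      using le by (elim disjE; linarith)
    moreover have "?b + m - c \<le> v"
      unfolding v_def
    proof (rule Min.boundedI)
      fix y assume "y \<in> ?F"
      then show "?b + m - c \<le> y"
        using le c_def G2_M_cases[of t] by (elim insertE emptyE disjE; linarith)
    qed simp_all
    ultimately show "?b + m \<le> G2_pi4 t"
      unfolding pi4 by linarith
  qed
  then show ?thesis by (simp only: m_def)
qed

section \<open>The four changes of parameters\<close>

lemma tropical_reverse:
  assumes "tropical n f" shows "tropical n (\<lambda>t. f (\<lambda>i. t (n + 1 - i)))"
  using assms
proof induction
  case (coord i)
  then show ?case by (intro tropical.coord) auto
qed (auto intro: tropical.intros)

text \<open>
  Reversing the order of the factors exchanges the two products that define a change of parameters,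
  so the inverse map is expected to be \<open>T\<close> conjugated by the reversal of indices.
\<close>

lemma tropical_bijectionI:
  assumes T: "\<And>i. i \<in> {1..n} \<Longrightarrow> tropical n (\<lambda>t. T t i)"
    and pos: "\<And>t i. \<forall>j\<in>{1..n}. 0 < t j \<Longrightarrow> i \<in> {1..n} \<Longrightarrow> 0 < T t i"
    and inv: "\<And>t i. \<forall>j\<in>{1..n}. 0 < t j \<Longrightarrow> i \<in> {1..n} \<Longrightarrow> T (\<lambda>j. T t (n + 1 - j)) (n + 1 - i) = t i"
  shows "tropical_bijection n T (\<lambda>t i. T (\<lambda>j. t (n + 1 - j)) (n + 1 - i))"
proof
  fix i :: nat assume i: "i \<in> {1..n}"
  have i': "n + 1 - i \<in> {1..n}" using i by auto
  show "tropical n (\<lambda>t. T t i)" by (rule T[OF i])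
  show "tropical n (\<lambda>t. T (\<lambda>j. t (n + 1 - j)) (n + 1 - i))"
    by (rule tropical_reverse[OF T[OF i']])
  fix t :: "nat \<Rightarrow> real" assume t: "\<forall>j\<in>{1..n}. 0 < t j"
  have t': "\<forall>j\<in>{1..n}. 0 < t (n + 1 - j)" by (intro ballI t[rule_format]) auto
  show "0 < T t i" by (rule pos[OF t i])
  show "0 < T (\<lambda>j. t (n + 1 - j)) (n + 1 - i)" by (rule pos[OF t' i'])
  show "T (\<lambda>j. T t (n + 1 - j)) (n + 1 - i) = t i" by (rule inv[OF t i])
  have "T (\<lambda>j. T (\<lambda>j. t (n + 1 - j)) (n + 1 - j)) i = t i"
    using inv[OF t' i'] i by simp
  then show "T (\<lambda>i. T (\<lambda>j. t (n + 1 - j)) (n + 1 - i)) i = t i" .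
qed

lemmas tropical_intros = tropical.coord tropical.zero tropical.add tropical.diff tropical.min tropical_numeral_mult

lemma interval_3: "{1..3} = {1, 2, 3::nat}" by auto
lemma interval_4: "{1..4} = {1, 2, 3, 4::nat}" by auto
lemma interval_6: "{1..6} = {1, 2, 3, 4, 5, 6::nat}" by auto

lemma A2_map_nth:
  "A2_map t 1 = t 2 + t 3 - min (t 1) (t 3)" "A2_map t 2 = min (t 1) (t 3)"
  "A2_map t 3 = t 1 + t 2 - min (t 1) (t 3)"
  by (simp_all add: A2_map_def tuple_def)

lemmas A2_map_simps = A2_map_nth[unfolded One_nat_def]

lemma tropical_bijection_A2:
  "tropical_bijection 3 A2_map (\<lambda>t i. A2_map (\<lambda>j. t (3 + 1 - j)) (3 + 1 - i))"
proof (rule tropical_bijectionI)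
  fix i :: nat assume i: "i \<in> {1..3}"
  then show "tropical 3 (\<lambda>t. A2_map t i)"
    unfolding interval_3 by (elim insertE emptyE; simp only: One_nat_def A2_map_simps) (intro tropical_intros; simp)+
  fix t :: "nat \<Rightarrow> real" assume t: "\<forall>j\<in>{1..3}. 0 < t j"
  show "0 < A2_map t i"
    using i t unfolding interval_3 by (auto simp: A2_map_simps)
  show "A2_map (\<lambda>j. A2_map t (3 + 1 - j)) (3 + 1 - i) = t i"
    using i unfolding interval_3 by (auto simp: A2_map_simps)
qed

lemma B2_map_nth:
  "B2_map t 1 = t 2 + 2 * t 3 + t 4 - B2_pi2 t" "B2_map t 2 = B2_pi2 t - B2_pi1 t"
  "B2_map t 3 = 2 * B2_pi1 t - B2_pi2 t" "B2_map t 4 = t 1 + t 2 + t 3 - B2_pi1 t"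
  by (simp_all add: B2_map_def tuple_def)

lemmas B2_map_simps = B2_map_nth[unfolded One_nat_def]

lemma B2_pi_eq:
  "B2_pi1 t = t 1 + t 2 + path_min [t 4 - t 2, t 3 - t 1]"
  "B2_pi2 t = 2 * t 1 + t 2 + path_min [t 4 - t 2, 2 * (t 3 - t 1)]"
  by (auto simp: B2_pi1_def B2_pi2_def path_min.simps min_def)

lemma tropical_bijection_B2:
  "tropical_bijection 4 B2_map (\<lambda>t i. B2_map (\<lambda>j. t (4 + 1 - j)) (4 + 1 - i))"
proof (rule tropical_bijectionI)
  fix i :: nat assume i: "i \<in> {1..4}"
  then show "tropical 4 (\<lambda>t. B2_map t i)"
    unfolding interval_4
    by (elim insertE emptyE; simp only: One_nat_def B2_map_simps B2_pi1_def B2_pi2_def)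
      (intro tropical_intros; simp)+
  fix t :: "nat \<Rightarrow> real" assume t: "\<forall>j\<in>{1..4}. 0 < t j"
  show "0 < B2_map t i"
    using i t unfolding interval_4 by (auto simp: B2_map_simps B2_pi1_def B2_pi2_def min_def)
  define m1 where "m1 = path_min [t 4 - t 2, t 3 - t 1]"
  define m2 where "m2 = path_min [t 4 - t 2, 2 * (t 3 - t 1)]"
  \<comment> \<open>The reversed image; its path minima are given by the lemma on the fan.\<close>
  define u where "u = (\<lambda>j. B2_map t (4 + 1 - j))"
  have u: "u 1 = t 3 - m1" "u 2 = t 2 + 2 * m1 - m2" "u 3 = t 1 + m2 - m1"
    "u 4 = t 4 + 2 * t 3 - 2 * t 1 - m2"
    by (simp_all add: u_def B2_map_simps B2_pi_eq m1_def m2_def)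
  have "path_min [u 4 - u 2, u 3 - u 1] = m2 - m1 \<and> path_min [u 4 - u 2, 2 * (u 3 - u 1)] = m2"
    by (rule B2_fan[OF m1_def m2_def]) (simp_all add: u del: One_nat_def)
  then have "B2_pi1 u = u 1 + u 2 + (m2 - m1)" "B2_pi2 u = 2 * u 1 + u 2 + m2"
    by (simp_all only: B2_pi_eq)
  then have "B2_map u 1 = t 4" "B2_map u 2 = t 3" "B2_map u 3 = t 2" "B2_map u 4 = t 1"
    unfolding B2_map_nth using u by linarith+
  then have "B2_map u (4 + 1 - i) = t i"
    using i unfolding interval_4 by auto
  then show "B2_map (\<lambda>j. B2_map t (4 + 1 - j)) (4 + 1 - i) = t i" by (simp only: u_def)
qed

lemma C2_map_nth:
  "C2_map t 1 = t 2 + t 3 + t 4 - C2_pi1 t" "C2_map t 2 = 2 * C2_pi1 t - C2_pi2 t"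
  "C2_map t 3 = C2_pi2 t - C2_pi1 t" "C2_map t 4 = t 1 + 2 * t 2 + t 3 - C2_pi2 t"
  by (simp_all add: C2_map_def tuple_def)

lemmas C2_map_simps = C2_map_nth[unfolded One_nat_def]

lemma C2_pi_eq:
  "C2_pi1 t = t 1 + t 2 + path_min [t 4 - t 2, t 3 - t 1]"
  "C2_pi2 t = t 1 + 2 * t 2 + path_min [2 * (t 4 - t 2), t 3 - t 1]"
  by (auto simp: C2_pi1_def C2_pi2_def path_min.simps min_def)

lemma tropical_bijection_C2:
  "tropical_bijection 4 C2_map (\<lambda>t i. C2_map (\<lambda>j. t (4 + 1 - j)) (4 + 1 - i))"
proof (rule tropical_bijectionI)
  fix i :: nat assume i: "i \<in> {1..4}"
  then show "tropical 4 (\<lambda>t. C2_map t i)"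
    unfolding interval_4
    by (elim insertE emptyE; simp only: One_nat_def C2_map_simps C2_pi1_def C2_pi2_def)
      (intro tropical_intros; simp)+
  fix t :: "nat \<Rightarrow> real" assume t: "\<forall>j\<in>{1..4}. 0 < t j"
  show "0 < C2_map t i"
    using i t unfolding interval_4 by (auto simp: C2_map_simps C2_pi1_def C2_pi2_def min_def)
  define m1 where "m1 = path_min [t 4 - t 2, t 3 - t 1]"
  define m2 where "m2 = path_min [2 * (t 4 - t 2), t 3 - t 1]"
  \<comment> \<open>The reversed image; its path minima are given by the lemma on the fan.\<close>
  define u where "u = (\<lambda>j. C2_map t (4 + 1 - j))"
  have u: "u 1 = t 3 - m2" "u 2 = t 2 + m2 - m1" "u 3 = t 1 + 2 * m1 - m2"
    "u 4 = t 4 + (t 3 - t 1) - m1"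
    by (simp_all add: u_def C2_map_simps C2_pi_eq m1_def m2_def)
  have "path_min [u 4 - u 2, u 3 - u 1] = m1 \<and> path_min [2 * (u 4 - u 2), u 3 - u 1] = 2 * m1 - m2"
    by (rule C2_fan[OF m1_def m2_def]) (simp_all add: u del: One_nat_def)
  then have "C2_pi1 u = u 1 + u 2 + m1" "C2_pi2 u = u 1 + 2 * u 2 + (2 * m1 - m2)"
    by (simp_all only: C2_pi_eq)
  then have "C2_map u 1 = t 4" "C2_map u 2 = t 3" "C2_map u 3 = t 2" "C2_map u 4 = t 1"
    unfolding C2_map_nth using u by linarith+
  then have "C2_map u (4 + 1 - i) = t i"
    using i unfolding interval_4 by auto
  then show "C2_map (\<lambda>j. C2_map t (4 + 1 - j)) (4 + 1 - i) = t i" by (simp only: u_def)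
qed

lemma G2_map_nth:
  "G2_map t 1 = t 2 + 3 * t 3 + 2 * t 4 + 3 * t 5 + t 6 - G2_pi3 t"
  "G2_map t 2 = G2_pi3 t - G2_pi2 t" "G2_map t 3 = 3 * G2_pi2 t - G2_pi3 t - G2_pi4 t"
  "G2_map t 4 = G2_pi4 t - G2_pi1 t - G2_pi2 t" "G2_map t 5 = 3 * G2_pi1 t - G2_pi4 t"
  "G2_map t 6 = t 1 + t 2 + 2 * t 3 + t 4 + t 5 - G2_pi1 t"
  by (simp_all add: G2_map_def tuple_def)

lemmas G2_map_simps = G2_map_nth[unfolded One_nat_def]

lemma G2_map_cone:
  assumes "G2_cone (t 6 - t 4) (t 5 - t 3) (t 4 - t 2) (t 3 - t 1) m1 m2 m3 m4"
  shows "G2_map t 1 = t 6 + 3 * t 5 - 3 * t 1 + t 4 - t 2 - m3" "G2_map t 2 = t 1 + m3 - m2"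
    "G2_map t 3 = t 2 + 3 * m2 - m3 - m4" "G2_map t 4 = t 3 + m4 - m1 - m2"
    "G2_map t 5 = t 4 + 3 * m1 - m4" "G2_map t 6 = t 5 - m1"
  using G2_cone_path_min[OF assms]
  by (simp_all add: G2_map_simps G2_pi1_eq G2_pi2_eq G2_pi3_eq G2_pi4_eq)

lemma tropical_bijection_G2:
  "tropical_bijection 6 G2_map (\<lambda>t i. G2_map (\<lambda>j. t (6 + 1 - j)) (6 + 1 - i))"
proof (rule tropical_bijectionI)
  fix i :: nat assume i: "i \<in> {1..6}"
  then show "tropical 6 (\<lambda>t. G2_map t i)"
    \<comment> \<open>In terms of path minima, which avoid the operator \<open>Min\<close> on finite sets.\<close>
    unfolding interval_6
    by (elim insertE emptyE; simp only: One_nat_def G2_map_simps G2_pi1_eq G2_pi2_eq G2_pi3_eq G2_pi4_eq path_min.simps)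
      (intro tropical_intros; simp)+
  fix t :: "nat \<Rightarrow> real" assume t: "\<forall>j\<in>{1..6}. 0 < t j"
  obtain m1 m2 m3 m4 where cone: "G2_cone (t 6 - t 4) (t 5 - t 3) (t 4 - t 2) (t 3 - t 1) m1 m2 m3 m4"
    using G2_cone_exists by blast
  have t_pos: "0 < t 1" "0 < t 2" "0 < t 3" "0 < t 4" "0 < t 5" "0 < t 6"
    using t by auto
  have "0 < t 6 + 3 * t 5 - 3 * t 1 + t 4 - t 2 - m3 \<and> 0 < t 1 + m3 - m2 \<and>
      0 < t 2 + 3 * m2 - m3 - m4 \<and> 0 < t 3 + m4 - m1 - m2 \<and> 0 < t 4 + 3 * m1 - m4 \<and> 0 < t 5 - m1"
    using G2_cone_pos[OF cone, of "t 1" "t 2"] t_pos by (simp add: algebra_simps)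
  then show "0 < G2_map t i"
    using i G2_map_cone[OF cone] unfolding interval_6 by auto
  \<comment> \<open>The reversed image, whose differences lie in the image cone.\<close>
  define u where "u = (\<lambda>j. G2_map t (6 + 1 - j))"
  have u: "u 6 = t 6 + 3 * t 5 - 3 * t 1 + t 4 - t 2 - m3" "u 5 = t 1 + m3 - m2"
    "u 4 = t 2 + 3 * m2 - m3 - m4" "u 3 = t 3 + m4 - m1 - m2"
    "u 2 = t 4 + 3 * m1 - m4" "u 1 = t 5 - m1"
    using G2_map_cone[OF cone] by (simp_all add: u_def)
  have "G2_cone (u 6 - u 4) (u 5 - u 3) (u 4 - u 2) (u 3 - u 1) (m3 - m2) (m3 - m1) m3 (2 * m3 - m4)"
    by (rule G2_cone_involution[OF cone]) (simp_all add: u del: One_nat_def)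
  from G2_map_cone[OF this]
  have "G2_map u 1 = t 6" "G2_map u 2 = t 5" "G2_map u 3 = t 4" "G2_map u 4 = t 3" "G2_map u 5 = t 2"
    "G2_map u 6 = t 1"
    unfolding u by (simp_all add: algebra_simps)
  then have "G2_map u (6 + 1 - i) = t i"
    using i unfolding interval_6 by auto
  then show "G2_map (\<lambda>j. G2_map t (6 + 1 - j)) (6 + 1 - i) = t i" by (simp only: u_def)
qed

section \<open>The exponential identities\<close>

theorem theorem3p4:
  fixes M :: "'w measure" and a1 a2 :: real
  assumes "prob_space M" and "0 < a1" and "0 < a2"
  shows
    "(longest_element A2 (s1 A2 \<circ> s2 A2 \<circ> s1 A2) \<and>
      s1 A2 \<circ> s2 A2 \<circ> s1 A2 = s2 A2 \<circ> s1 A2 \<circ> s2 A2 \<and>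
      (\<forall>t. random_vector M 3 t \<and> positive_coordinates M 3 t \<longrightarrow>
        (law M 3 t = exp_law [a1, a1 + a2, a2] \<longleftrightarrow>
         law M 3 (\<lambda>\<omega>. A2_map (t \<omega>)) = exp_law [a2, a1 + a2, a1]))) \<and>
     (longest_element B2 (s1 B2 \<circ> s2 B2 \<circ> s1 B2 \<circ> s2 B2) \<and>
      s1 B2 \<circ> s2 B2 \<circ> s1 B2 \<circ> s2 B2 = s2 B2 \<circ> s1 B2 \<circ> s2 B2 \<circ> s1 B2 \<and>
      (\<forall>t. random_vector M 4 t \<and> positive_coordinates M 4 t \<longrightarrow>
        (law M 4 t = exp_law [a1, a1 + a2, a1 + 2 * a2, a2] \<longleftrightarrow>
         law M 4 (\<lambda>\<omega>. B2_map (t \<omega>)) = exp_law [a2, a1 + 2 * a2, a1 + a2, a1]))) \<and>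
     (longest_element C2 (s1 C2 \<circ> s2 C2 \<circ> s1 C2 \<circ> s2 C2) \<and>
      s1 C2 \<circ> s2 C2 \<circ> s1 C2 \<circ> s2 C2 = s2 C2 \<circ> s1 C2 \<circ> s2 C2 \<circ> s1 C2 \<and>
      (\<forall>t. random_vector M 4 t \<and> positive_coordinates M 4 t \<longrightarrow>
        (law M 4 t = exp_law [a1, 2 * a1 + a2, a1 + a2, a2] \<longleftrightarrow>
         law M 4 (\<lambda>\<omega>. C2_map (t \<omega>)) = exp_law [a2, a1 + a2, 2 * a1 + a2, a1]))) \<and>
     (longest_element G2 (s1 G2 \<circ> s2 G2 \<circ> s1 G2 \<circ> s2 G2 \<circ> s1 G2 \<circ> s2 G2) \<and>
      s1 G2 \<circ> s2 G2 \<circ> s1 G2 \<circ> s2 G2 \<circ> s1 G2 \<circ> s2 G2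
        = s2 G2 \<circ> s1 G2 \<circ> s2 G2 \<circ> s1 G2 \<circ> s2 G2 \<circ> s1 G2 \<and>
      (\<forall>t. random_vector M 6 t \<and> positive_coordinates M 6 t \<longrightarrow>
        (law M 6 t
           = exp_law [a1, a1 + a2, 2 * a1 + 3 * a2, a1 + 2 * a2, a1 + 3 * a2, a2] \<longleftrightarrow>
         law M 6 (\<lambda>\<omega>. G2_map (t \<omega>))
           = exp_law [a2, a1 + 3 * a2, a1 + 2 * a2, 2 * a1 + 3 * a2, a1 + a2, a1])))"
proof -
  have balance_A2: "(\<Sum>i\<in>{1..3}. tuple [a1, a1 + a2, a2] i * t i)
      = (\<Sum>i\<in>{1..3}. tuple [a2, a1 + a2, a1] i * A2_map t i)" for t
    unfolding interval_3 by (simp add: tuple_def A2_map_simps algebra_simps)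
  have balance_B2: "(\<Sum>i\<in>{1..4}. tuple [a1, a1 + a2, a1 + 2 * a2, a2] i * t i)
      = (\<Sum>i\<in>{1..4}. tuple [a2, a1 + 2 * a2, a1 + a2, a1] i * B2_map t i)" for t
    unfolding interval_4 by (simp add: tuple_def B2_map_simps algebra_simps)
  have balance_C2: "(\<Sum>i\<in>{1..4}. tuple [a1, 2 * a1 + a2, a1 + a2, a2] i * t i)
      = (\<Sum>i\<in>{1..4}. tuple [a2, a1 + a2, 2 * a1 + a2, a1] i * C2_map t i)" for t
    unfolding interval_4 by (simp add: tuple_def C2_map_simps algebra_simps)
  have balance_G2: "(\<Sum>i\<in>{1..6}. tuple [a1, a1 + a2, 2 * a1 + 3 * a2, a1 + 2 * a2, a1 + 3 * a2, a2] i * t i)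
      = (\<Sum>i\<in>{1..6}. tuple [a2, a1 + 3 * a2, a1 + 2 * a2, 2 * a1 + 3 * a2, a1 + a2, a1] i * G2_map t i)" for t
    unfolding interval_6 by (simp add: tuple_def G2_map_simps algebra_simps)
  show ?thesis
    using assms(2,3)
    by (intro conjI allI impI longest_element_A2 longest_element_B2 longest_element_C2 longest_element_G2
        tropical_bijection.law_iff[OF tropical_bijection_A2 assms(1) _ _ _ _ _ _ balance_A2]
        tropical_bijection.law_iff[OF tropical_bijection_B2 assms(1) _ _ _ _ _ _ balance_B2]
        tropical_bijection.law_iff[OF tropical_bijection_C2 assms(1) _ _ _ _ _ _ balance_C2]
        tropical_bijection.law_iff[OF tropical_bijection_G2 assms(1) _ _ _ _ _ _ balance_G2])
      auto
qed

end
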